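(* For $\lambda\in(0,1]$ let $(\phi_\lambda,\nu_\lambda)$ be a limiting solution pair of relative height $\lambda$ (as defined in the context), let $\varphi_\lambda=\phi_\lambda+1-\nu_\lambda$, $\mu_\lambda=2-\nu_\lambda$ be the corresponding solitary solution and its wave speed, and let $\alpha_\lambda=\frac{\varphi_\lambda(0)}{\mu_\lambda/2}$ be the relative height of $\varphi_\lambda$. Then always $$\mu_\lambda<\frac{2}{2-\alpha_\lambda}.$$ Moreover, for $\alpha_\lambda$ close enough to $1$, the wave speed is uniformly bounded away from $2$ by a positive constant depending only on the regularity estimate (R) of the context: there exist $\alpha_0\in(0,1)$ and $\varepsilon>0$, depending only on the constant $\delta$ in (R), such that $\mu_\lambda\le2-\varepsilon$ whenever $\alpha_\lambda\ge\alpha_0$.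
   Context: Let $m(\xi)=\sqrt{\tanh(\xi)/\xi}$ (with $m(0)=1$) and let $K(x)=\frac{1}{2\pi}\int_{\mathbb{R}}m(\xi)e^{ix\xi}\,d\xi$ be the Whitham kernel; $K$ is even, positive, and integrable with $\|K\|_{L^1(\mathbb{R})}=1$. Let $Lf=K\ast f$. The steady Whitham equation with wave speed $\mu$ is $-\mu\varphi+L\varphi+\varphi^2=0$, required to hold pointwise in $\mathbb{R}$; then $(\varphi,\mu)$ is called a solution pair. Admissible periodic solution pairs: for finite $P>0$ and $\lambda\in(0,1]$, an admissible $P$-periodic solution pair of relative height $\lambda$ is a pair $(\varphi_{P,\lambda},\mu_{P,\lambda})$ such that $\varphi_{P,\lambda}\in C^{1/2}(\mathbb{R})$ (Hölder space) is a $P$-periodic solution of the steady Whitham equation with wave speed $\mu_{P,\lambda}$; $0<\mu_{P,\lambda}\le1$; $\mu_{P,\lambda}-1\le\varphi_{P,\lambda}\le\varphi_{P,\lambda}(0)=\frac{\lambda\mu_{P,\lambda}}{2}$; $\varphi_{P,\lambda}$ is even, strictly increasing on $(-P/2,0)$ and smooth on $\mathbb{R}\setminus P\mathbb{Z}$; and $\varphi_{P,\lambda}\in C^\infty(\mathbb{R})$ if $\lambda\in(0,1)$. (Such pairs are known to exist for every $P>0$ and $\lambda\in(0,1]$ by earlier work of Ehrnström and Wahlén.) Regularity estimate (R): there is a constant $\delta>0$ such that $\frac{\mu_{P,\lambda}}{2}-\varphi_{P,\lambda}(x)\ge\delta|x|^{1/2}$ for all $P\ge1$, $\lambda\in(0,1]$,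 $|x|\le\delta$ and all admissible $P$-periodic solution pairs of relative height $\lambda$. Limiting solution pairs: a limiting solution pair of relative height $\lambda$ is a pair $(\phi_\lambda,\nu_\lambda)\in C(\mathbb{R})\times[0,1]$ which is the limit, locally uniformly on $\mathbb{R}$ in the first component, of a sequence of admissible $P_n$-periodic solution pairs of relative height $\lambda$ with $P_n\to\infty$. It is known that every such pair solves the steady Whitham equation with wave speed $\nu_\lambda$ and has $\phi_\lambda(0)=\lambda\nu_\lambda/2$, and that the transformed pair $(\varphi_\lambda,\mu_\lambda)=(\phi_\lambda+1-\nu_\lambda,\,2-\nu_\lambda)$ is a positive, even, continuous solution of the steady Whitham equation with $\mu_\lambda\in(1,2)$, strictly decreasing on $(0,\infty)$, tending to $0$ at $\pm\infty$, with $\varphi_\lambda(0)=\mu_\lambda-1+\lambda(1-\frac{\mu_\lambda}{2})$. *)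

theory Defs
  imports "HOL-Analysis.Analysis" "HOL-Library.Periodic_Fun"
begin

definition whitham_symbol :: "real \<Rightarrow> real" where
  "whitham_symbol \<xi> = (if \<xi> = 0 then 1 else sqrt (tanh \<xi> / \<xi>))"

text \<open>
  The symbol decays like \<open>\<bar>\<xi>\<bar> powr (-1/2)\<close> and is not Lebesgue integrable, so the
  Fourier integral defining the kernel is read as the limit of its symmetric truncations. This
  limit exists for \<open>x \<noteq> 0\<close>; at \<open>x = 0\<close> the integral diverges and the value of \<open>Lim\<close> is
  unspecified, which does not affect convolutions. The limit is a real number, and \<open>Re\<close> only
  adjusts the type.
\<close>

definition whitham_kernel :: "real \<Rightarrow> real" where
  "whitham_kernel x =
     1 / (2 * pi) *
     Re (Lim at_top (\<lambda>R::real.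
           CLBINT \<xi>:{-R..R}. of_real (whitham_symbol \<xi>) * exp (\<i> * of_real x * of_real \<xi>)))"

definition whitham_op :: "(real \<Rightarrow> real) \<Rightarrow> real \<Rightarrow> real" where
  "whitham_op f x = (LBINT y. whitham_kernel (x - y) * f y)"

definition solution_pair :: "(real \<Rightarrow> real) \<Rightarrow> real \<Rightarrow> bool" where
  "solution_pair \<phi> \<mu> \<longleftrightarrow> (\<forall>x. - \<mu> * \<phi> x + whitham_op \<phi> x + (\<phi> x)\<^sup>2 = 0)"

definition holder_space :: "real \<Rightarrow> (real \<Rightarrow> real) set" where
  "holder_space a =
     {f. bounded (range f) \<and> (\<exists>C. \<forall>x y. \<bar>f x - f y\<bar> \<le> C * \<bar>x - y\<bar> powr a)}"

text \<open>Infinite differentiability on \<open>S\<close>; only used for open \<open>S\<close>.\<close>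

definition smooth_on :: "real set \<Rightarrow> (real \<Rightarrow> real) \<Rightarrow> bool" where
  "smooth_on S f \<longleftrightarrow> (\<forall>n. \<forall>x\<in>S. (deriv ^^ n) f differentiable (at x))"

definition admissible_pair ::
  "real \<Rightarrow> real \<Rightarrow> (real \<Rightarrow> real) \<Rightarrow> real \<Rightarrow> bool" where
  "admissible_pair P lam \<phi> \<mu> \<longleftrightarrow>
     0 < P \<and> 0 < lam \<and> lam \<le> 1 \<and>
     \<phi> \<in> holder_space (1/2) \<and>
     periodic_fun_simple \<phi> P \<and>
     solution_pair \<phi> \<mu> \<and>
     0 < \<mu> \<and> \<mu> \<le> 1 \<and>
     (\<forall>x. \<mu> - 1 \<le> \<phi> x \<and> \<phi> x \<le> \<phi> 0) \<and>
     \<phi> 0 = lam * \<mu> / 2 \<and>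
     (\<forall>x. \<phi> (- x) = \<phi> x) \<and>
     strict_mono_on {- P / 2<..<0} \<phi> \<and>
     smooth_on (UNIV - range (\<lambda>k::int. P * of_int k)) \<phi> \<and>
     (lam < 1 \<longrightarrow> smooth_on UNIV \<phi>)"

definition regularity_estimate :: "real \<Rightarrow> bool" where
  "regularity_estimate \<delta> \<longleftrightarrow>
     0 < \<delta> \<and>
     (\<forall>P lam \<phi> \<mu> x.
        1 \<le> P \<longrightarrow> 0 < lam \<longrightarrow> lam \<le> 1 \<longrightarrow> \<bar>x\<bar> \<le> \<delta> \<longrightarrow> admissible_pair P lam \<phi> \<mu> \<longrightarrow>
          \<mu> / 2 - \<phi> x \<ge> \<delta> * \<bar>x\<bar> powr (1/2))"

text \<open>Locally uniform convergence on the real line is uniform convergence on compact sets.\<close>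

definition limiting_pair :: "real \<Rightarrow> (real \<Rightarrow> real) \<Rightarrow> real \<Rightarrow> bool" where
  "limiting_pair lam \<phi> \<nu> \<longleftrightarrow>
     continuous_on UNIV \<phi> \<and> \<nu> \<in> {0..1} \<and>
     (\<exists>(P :: nat \<Rightarrow> real) (\<phi>s :: nat \<Rightarrow> real \<Rightarrow> real) (\<mu>s :: nat \<Rightarrow> real).
        (\<forall>n. admissible_pair (P n) lam (\<phi>s n) (\<mu>s n)) \<and>
        filterlim P at_top sequentially \<and>
        (\<forall>C. compact C \<longrightarrow> uniform_limit C \<phi>s \<phi> sequentially) \<and>
        \<mu>s \<longlonglongrightarrow> \<nu>)"

definition solitary_wave :: "(real \<Rightarrow> real) \<Rightarrow> real \<Rightarrow> real \<Rightarrow> real" where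
  "solitary_wave \<phi> \<nu> = (\<lambda>x. \<phi> x + 1 - \<nu>)"

definition solitary_speed :: "real \<Rightarrow> real" where
  "solitary_speed \<nu> = 2 - \<nu>"

definition relative_height :: "(real \<Rightarrow> real) \<Rightarrow> real \<Rightarrow> real" where
  "relative_height \<phi> \<mu> = \<phi> 0 / (\<mu> / 2)"

end

theory Submission
  imports Defs "HOL-Probability.Sinc_Integral" "HOL-Real_Asymp.Real_Asymp"
begin

text \<open>
  Writing \<open>\<alpha>\<close> for the relative height, the identity \<open>\<phi> 0 = \<lambda> * \<nu> / 2\<close> turns \<open>2 / (2 - \<alpha>)\<close> into
  \<open>2 * (2 - \<nu>) / (2 - \<lambda> * \<nu>)\<close>. Hence the first claim says exactly that \<open>\<nu> > 0\<close>, and both claims follow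
  from one bound \<open>\<nu> \<ge> \<epsilon> > 0\<close> with \<open>\<epsilon>\<close> depending on \<open>\<delta>\<close> alone.

  The bound comes from the equation of a periodic wave at its crest. There
  \<open>L \<phi> 0 = \<phi> 0 * (\<mu> - \<phi> 0) \<ge> 0\<close>. On the other hand the regularity estimate near the crest and the
  monotonicity of the wave keep \<open>\<phi>\<close> below \<open>\<mu> / 2 - w\<close> on half a period to each side, where \<open>w\<close> is
  the nonnegative function \<open>deficit \<delta>\<close>. As \<open>K\<close> is nonnegative off the origin and has mass 1, this gives
  \<open>L \<phi> 0 \<le> \<mu> / 2 - c\<close>, where \<open>c\<close> is the integral of \<open>K * w\<close> over a fixed interval
  (\<open>admissible_speed_ge\<close>). So \<open>\<mu> \<ge> 2 * c\<close>, uniformly in the height and in all long periods, and the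
  bound passes to the limit. Finally \<open>c > 0\<close> on a large interval, since \<open>K\<close> has mass 1 and \<open>w\<close>
  vanishes only at the origin.

  The facts about \<open>K\<close> have to be extracted from its definition as a conditionally convergent
  Fourier integral. The symbol \<open>m\<close> decreases from 1 to 0 on the half-line, so \<open>slope = - m'\<close> is a
  probability density there, and integrating by parts gives the absolutely convergent formula
  \<open>K x = 1 / pi * (LBINT t. slope t * (sin (x * t) / x))\<close> for \<open>x \<noteq> 0\<close> (\<open>kernel_eq\<close>). It makes \<open>K\<close>
  even and measurable, and integrating it in \<open>x\<close> produces sine integrals, whose limit \<open>pi / 2\<close>
  yields the mass once \<open>K \<ge> 0\<close> is known (\<open>has_bochner_integral_kernel\<close>).

  Positivity expresses that \<open>m\<close> is a positive definite function. Partial fractions write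
  \<open>\<xi> * coth \<xi>\<close> as the limit of \<open>1 + 2 * N - S N \<xi>\<close>, where \<open>S N\<close> is a sum of terms
  \<open>2 * (c\<^sup>2 / (c\<^sup>2 + \<xi>\<^sup>2))\<close>. Each of these is twice the characteristic function of a Laplace
  distribution. Since \<open>m \<xi>\<close> is \<open>(\<xi> * coth \<xi>) powr (- (1/2))\<close> and the binomial series of
  \<open>(A - s) powr (- (1/2))\<close> has nonnegative coefficients, \<open>m\<close> is a limit of nonnegative combinations
  of products of such characteristic functions (\<open>fejer_positive_symbol\<close>).
\<close>

section \<open>Partial fractions of the hyperbolic cotangent\<close>

text \<open>
  Differentiating the reflection formula \<open>rGamma z * rGamma (1 - z) = sin (pi * z) / pi\<close>
  logarithmically gives \<open>pi * cot (pi * z) = Digamma (1 - z) - Digamma z\<close>. In the limit formula for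
  \<open>Digamma\<close> the logarithms cancel and the two sums combine term by term.
\<close>
lemma cot_partial_fractions:
  fixes z :: complex
  assumes z: "z \<notin> \<int>"
  shows "(\<lambda>N. \<Sum>n<N. 2 * z / (z\<^sup>2 - (of_nat n + 1)\<^sup>2)) \<longlonglongrightarrow> pi * cos (of_real pi * z) / sin (of_real pi * z) - 1 / z"
proof -
  have nz: "z + of_nat n \<noteq> 0" "1 - z + of_nat n \<noteq> 0" for n
  proof -
    show "z + of_nat n \<noteq> 0"
      using z by (metis Ints_minus Ints_of_nat add_eq_0_iff2)
    have "z = of_nat (Suc n)" if "1 - z + of_nat n = 0"
      using that by (simp add: algebra_simps)
    then show "1 - z + of_nat n \<noteq> 0" using z by auto
  qed
  have [simp]: "z \<noteq> 0" "1 - z \<noteq> 0" using nz[of 0] by auto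
  have nonpos: "z \<notin> \<int>\<^sub>\<le>\<^sub>0" "1 - z \<notin> \<int>\<^sub>\<le>\<^sub>0"
    using z by (auto elim!: nonpos_Ints_cases simp: algebra_simps)
       (metis Ints_1 Ints_diff Ints_of_int diff_eq_eq)+
  have reflection: "rGamma w * rGamma (1 - w) = sin (of_real pi * w) / of_real pi" for w :: complex
    by (rule rGamma_reflection_complex)
  have "((\<lambda>w. rGamma w * rGamma (1 - w)) has_field_derivative
      (- rGamma z * Digamma z) * rGamma (1 - z) + rGamma z * ((- rGamma (1 - z) * Digamma (1 - z)) * (- 1))) (at z)"
    using nonpos by (auto intro!: derivative_eq_intros simp: algebra_simps)
  moreover have "((\<lambda>w. rGamma w * rGamma (1 - w)) has_field_derivative cos (of_real pi * z)) (at z)"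
    unfolding reflection by (auto intro!: derivative_eq_intros)
  ultimately have "cos (of_real pi * z) =
      (- rGamma z * Digamma z) * rGamma (1 - z) + rGamma z * ((- rGamma (1 - z) * Digamma (1 - z)) * (- 1))"
    by (rule DERIV_unique[symmetric])
  also have "\<dots> = (rGamma z * rGamma (1 - z)) * (Digamma (1 - z) - Digamma z)"
    by (simp add: algebra_simps)
  finally have cos: "of_real pi * cos (of_real pi * z) = sin (of_real pi * z) * (Digamma (1 - z) - Digamma z)"
    by (simp add: reflection)
  have sin: "sin (of_real pi * z) \<noteq> 0"
    using reflection[of z] nonpos by (auto simp: rGamma_eq_zero_iff)
  \<comment> \<open>Shifting \<open>z\<close> to \<open>z + 1\<close> splits off the pole at the origin and makes the two sums symmetric.\<close>
  have "(\<lambda>N. (of_real (ln (real N)) - (\<Sum>n<N. inverse (1 - z + of_nat n)))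
            - (of_real (ln (real N)) - (\<Sum>n<N. inverse (z + 1 + of_nat n)))) \<longlonglongrightarrow> Digamma (1 - z) - Digamma (z + 1)"
    using nz(1)[of 1] nz(2)[of 0] by (intro tendsto_diff Digamma_LIMSEQ) auto
  also have "(\<lambda>N. (of_real (ln (real N)) - (\<Sum>n<N. inverse (1 - z + of_nat n)))
            - (of_real (ln (real N)) - (\<Sum>n<N. inverse (z + 1 + of_nat n)))) =
     (\<lambda>N. \<Sum>n<N. 2 * z / (z\<^sup>2 - (of_nat n + 1)\<^sup>2))"
  proof
    fix N
    have "inverse (z + 1 + of_nat n) - inverse (1 - z + of_nat n) = 2 * z / (z\<^sup>2 - (of_nat n + 1)\<^sup>2)" for n
    proof -
      have "z\<^sup>2 - (of_nat n + 1)\<^sup>2 = - ((z + 1 + of_nat n) * (1 - z + of_nat n))"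
        by (simp add: algebra_simps power2_eq_square)
      moreover have "inverse a - inverse b = (b - a) / (a * b)" if "a \<noteq> 0" "b \<noteq> 0" for a b :: complex
        using that by (simp add: field_simps)
      ultimately show ?thesis using nz(1)[of "Suc n"] nz(2)[of n]
        by (simp add: add_ac)
    qed
    then show "(of_real (ln (real N)) - (\<Sum>n<N. inverse (1 - z + of_nat n)))
            - (of_real (ln (real N)) - (\<Sum>n<N. inverse (z + 1 + of_nat n))) = (\<Sum>n<N. 2 * z / (z\<^sup>2 - (of_nat n + 1)\<^sup>2))"
      by (simp add: sum_subtractf[symmetric])
  qed
  also have "Digamma (1 - z) - Digamma (z + 1) = pi * cos (of_real pi * z) / sin (of_real pi * z) - 1 / z"
  proof -
    have "Digamma (1 - z) - Digamma z = pi * cos (of_real pi * z) / sin (of_real pi * z)"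
      using cos sin by simp
    then show ?thesis by (simp add: Digamma_plus1 diff_diff_eq[symmetric])
  qed
  finally show ?thesis .
qed

lemma coth_partial_fractions:
  fixes \<xi> :: real
  assumes "\<xi> \<noteq> 0"
  shows "(\<lambda>N. \<Sum>n<N. 2 * \<xi>\<^sup>2 / (\<xi>\<^sup>2 + (real (Suc n) * pi)\<^sup>2)) \<longlonglongrightarrow> \<xi> * cosh \<xi> / sinh \<xi> - 1"
proof -
  \<comment> \<open>At this point of the imaginary axis the trigonometric functions of \<open>pi * z\<close> become hyperbolic.\<close>
  define z where "z = \<i> * of_real (\<xi> / pi)"
  have z: "z \<notin> \<int>"
    using assms by (auto simp: z_def elim!: Ints_cases dest!: arg_cong[where f = Im])
  have pz: "of_real pi * z = \<i> * of_real \<xi>" by (simp add: z_def)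
  have c: "cos (of_real pi * z) = of_real (cosh \<xi>)"
    unfolding pz by (simp add: cosh_conv_cos[symmetric] cosh_def exp_of_real scaleR_conv_of_real flip: of_real_minus)
  have s: "sin (of_real pi * z) = \<i> * of_real (sinh \<xi>)"
    unfolding pz by (simp add: sin_conv_sinh sinh_def exp_of_real scaleR_conv_of_real algebra_simps flip: of_real_minus)
  have [simp]: "sinh \<xi> \<noteq> 0" using assms by simp
  have "(\<lambda>N. z * (\<Sum>n<N. 2 * z / (z\<^sup>2 - (of_nat n + 1)\<^sup>2))) \<longlonglongrightarrow>
     z * (pi * cos (of_real pi * z) / sin (of_real pi * z) - 1 / z)"
    by (intro tendsto_mult tendsto_const cot_partial_fractions z)
  also have "(\<lambda>N. z * (\<Sum>n<N. 2 * z / (z\<^sup>2 - (of_nat n + 1)\<^sup>2))) =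
     (\<lambda>N. of_real (\<Sum>n<N. 2 * \<xi>\<^sup>2 / (\<xi>\<^sup>2 + (real (Suc n) * pi)\<^sup>2)))"
  proof
    fix N
    have "z * (2 * z / (z\<^sup>2 - (of_nat n + 1)\<^sup>2)) = of_real (2 * \<xi>\<^sup>2 / (\<xi>\<^sup>2 + (real (Suc n) * pi)\<^sup>2))" for n
    proof -
      have z2: "z\<^sup>2 = of_real (- (\<xi>\<^sup>2 / pi\<^sup>2))" by (simp add: z_def power_mult_distrib power_divide)
      have "z * (2 * z / (z\<^sup>2 - (of_nat n + 1)\<^sup>2)) = 2 * z\<^sup>2 / (z\<^sup>2 - (of_nat n + 1)\<^sup>2)"
        by (simp add: power2_eq_square)
      also have "\<dots> = of_real (2 * (- (\<xi>\<^sup>2 / pi\<^sup>2)) / (- (\<xi>\<^sup>2 / pi\<^sup>2) - (real n + 1)\<^sup>2))"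
        unfolding z2 by simp
      also have "2 * (- (\<xi>\<^sup>2 / pi\<^sup>2)) / (- (\<xi>\<^sup>2 / pi\<^sup>2) - (real n + 1)\<^sup>2) = 2 * \<xi>\<^sup>2 / (\<xi>\<^sup>2 + (real (Suc n) * pi)\<^sup>2)"
      proof -
        define s where "s = \<xi>\<^sup>2 + (real (Suc n) * pi)\<^sup>2"
        have "- (\<xi>\<^sup>2 / pi\<^sup>2) - (real n + 1)\<^sup>2 = - (s / pi\<^sup>2)"
          by (simp add: s_def power_mult_distrib add_divide_distrib add.commute)
        then show ?thesis unfolding s_def[symmetric] by simp
      qed
      finally show ?thesis .
    qed
    then show "z * (\<Sum>n<N. 2 * z / (z\<^sup>2 - (of_nat n + 1)\<^sup>2)) = of_real (\<Sum>n<N. 2 * \<xi>\<^sup>2 / (\<xi>\<^sup>2 + (real (Suc n) * pi)\<^sup>2))"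
      by (simp add: sum_distrib_left)
  qed
  also have "z * (pi * cos (of_real pi * z) / sin (of_real pi * z) - 1 / z) = of_real (\<xi> * cosh \<xi> / sinh \<xi> - 1)"
    unfolding c s using assms by (simp add: z_def field_simps)
  finally show ?thesis by (subst (asm) tendsto_of_real_iff)
qed

section \<open>The symbol and its slope\<close>

abbreviation "m \<equiv> whitham_symbol"

text \<open>
  The function \<open>tanh x - x * (1 - (tanh x)\<^sup>2)\<close> vanishes at 0 and has the nonnegative derivative
  \<open>2 * x * tanh x * (1 - (tanh x)\<^sup>2)\<close>. It is the numerator of \<open>- m'\<close>, so its sign is what makes
  the symbol decreasing.
\<close>
lemma tanh_ge_self_mult_deriv:
  fixes x :: real assumes "0 \<le> x" shows "x * (1 - (tanh x)\<^sup>2) \<le> tanh x"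
proof -
  have sq: "(tanh y)\<^sup>2 \<le> 1" for y :: real
    using tanh_real_bounds[of y] by (simp add: abs_square_le_1 abs_le_iff less_imp_le)
  have "tanh 0 - 0 * (1 - (tanh 0)\<^sup>2) \<le> tanh x - x * (1 - (tanh x)\<^sup>2)"
    using assms
  proof (rule DERIV_nonneg_imp_nondecreasing)
    fix y :: real assume "0 \<le> y" "y \<le> x"
    have "((\<lambda>x. tanh x - x * (1 - (tanh x)\<^sup>2)) has_real_derivative 2 * y * tanh y * (1 - (tanh y)\<^sup>2)) (at y)"
      by (auto intro!: derivative_eq_intros simp: algebra_simps power2_eq_square)
    moreover have "0 \<le> 2 * y * tanh y * (1 - (tanh y)\<^sup>2)"
      using \<open>0 \<le> y\<close> sq[of y] by simp
    ultimately show "\<exists>d. ((\<lambda>x. tanh x - x * (1 - (tanh x)\<^sup>2)) has_real_derivative d) (at y) \<and> 0 \<le> d"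
      by blast
  qed
  then show ?thesis by simp
qed

lemma symbol_minus [simp]: "m (- \<xi>) = m \<xi>"
  by (simp add: whitham_symbol_def)

lemma symbol_pos: "0 < m \<xi>"
  by (auto simp: whitham_symbol_def zero_less_divide_iff)

lemma symbol_measurable [measurable]: "m \<in> borel_measurable borel"
proof -
  have [measurable]: "(tanh :: real \<Rightarrow> real) \<in> borel_measurable borel"
    by (intro borel_measurable_continuous_onI continuous_intros) auto
  show ?thesis unfolding whitham_symbol_def by measurable
qed

lemma isCont_symbol: "isCont m \<xi>"
proof (cases "\<xi> = 0")
  case True
  have "((\<lambda>x::real. tanh x) has_real_derivative 1) (at 0)"
    by (auto intro!: derivative_eq_intros)
  then have "((\<lambda>x::real. tanh x / x) \<longlongrightarrow> 1) (at 0)"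
    by (simp add: has_field_derivative_iff)
  then have "((\<lambda>x::real. sqrt (tanh x / x)) \<longlongrightarrow> 1) (at 0)"
    using tendsto_real_sqrt by fastforce
  then have "(m \<longlongrightarrow> 1) (at 0)"
    by (rule Lim_transform_eventually) (auto simp: eventually_at_filter whitham_symbol_def)
  then show ?thesis using True by (simp add: isCont_def whitham_symbol_def)
next
  case False
  then have "isCont (\<lambda>x. sqrt (tanh x / x)) \<xi>"
    by (intro continuous_intros) auto
  moreover have "eventually (\<lambda>x. m x = sqrt (tanh x / x)) (nhds \<xi>)"
    using t1_space_nhds[OF False] by eventually_elim (simp add: whitham_symbol_def)
  ultimately show ?thesis by (simp add: isCont_cong)
qed

lemma continuous_on_symbol: "continuous_on A m"
  by (simp add: continuous_at_imp_continuous_on isCont_symbol)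

lemma symbol_tendsto_0: "(m \<longlongrightarrow> 0) at_top"
proof (rule tendsto_sandwich)
  show "\<forall>\<^sub>F \<xi> in at_top. 0 \<le> m \<xi>" using symbol_pos by (simp add: less_imp_le)
  show "\<forall>\<^sub>F \<xi> in at_top. m \<xi> \<le> sqrt (1 / \<xi>)"
    using eventually_gt_at_top[of 0]
  proof eventually_elim
    case (elim \<xi>)
    then show ?case using tanh_real_bounds[of \<xi>]
      by (auto simp: whitham_symbol_def divide_le_cancel)
  qed
  have "((\<lambda>\<xi>. sqrt (1 / \<xi>)) \<longlongrightarrow> sqrt 0) at_top"
    by (intro tendsto_real_sqrt) real_asymp
  then show "((\<lambda>\<xi>. sqrt (1 / \<xi>)) \<longlongrightarrow> (0::real)) at_top" by simp
qed simp

text \<open>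
  This is \<open>- m'\<close> on the positive half-line. Extended by zero it becomes a probability density on the
  line, because \<open>m\<close> falls from 1 to 0.
\<close>
definition slope :: "real \<Rightarrow> real" where
  "slope \<xi> = (if \<xi> \<le> 0 then 0 else (tanh \<xi> - \<xi> * (1 - (tanh \<xi>)\<^sup>2)) / (2 * \<xi>\<^sup>2 * m \<xi>))"

lemma slope_nonneg: "0 \<le> slope \<xi>"
  using tanh_ge_self_mult_deriv[of \<xi>] symbol_pos[of \<xi>]
  by (auto simp: slope_def intro!: divide_nonneg_nonneg less_imp_le[OF symbol_pos])

lemma symbol_has_derivative:
  assumes "0 < \<xi>" shows "(m has_real_derivative - slope \<xi>) (at \<xi>)"
proof -
  have pos: "tanh \<xi> / \<xi> > 0" using assms by simp
  have "((\<lambda>x. sqrt (tanh x / x)) has_real_derivative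
      ((1 - (tanh \<xi>)\<^sup>2) * \<xi> - tanh \<xi>) / \<xi>\<^sup>2 * (inverse (sqrt (tanh \<xi> / \<xi>)) / 2)) (at \<xi>)"
    using assms pos by (auto intro!: derivative_eq_intros simp: power2_eq_square mult_ac dest: order.asym)
  also have "((1 - (tanh \<xi>)\<^sup>2) * \<xi> - tanh \<xi>) / \<xi>\<^sup>2 * (inverse (sqrt (tanh \<xi> / \<xi>)) / 2) = - slope \<xi>"
    using assms by (simp add: slope_def whitham_symbol_def divide_simps mult_ac)
  finally show ?thesis
    by (rule has_field_derivative_transform_within_open[where S = "{0<..}"])
       (use assms in \<open>auto simp: whitham_symbol_def\<close>)
qed

lemma isCont_slope: "0 < \<xi> \<Longrightarrow> isCont slope \<xi>"
proof -
  assume \<xi>: "0 < \<xi>"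
  have "isCont (\<lambda>\<xi>. (tanh \<xi> - \<xi> * (1 - (tanh \<xi>)\<^sup>2)) / (2 * \<xi>\<^sup>2 * m \<xi>)) \<xi>"
    using \<xi> symbol_pos[of \<xi>] by (intro continuous_intros isCont_symbol) auto
  moreover have "eventually (\<lambda>x. slope x = (tanh x - x * (1 - (tanh x)\<^sup>2)) / (2 * x\<^sup>2 * m x)) (nhds \<xi>)"
    using eventually_nhds_in_open[of "{0<..}" \<xi>] \<xi>
    by (auto simp: slope_def elim!: eventually_mono)
  ultimately show ?thesis by (simp add: isCont_cong)
qed

lemma has_bochner_integral_slope: "has_bochner_integral lborel slope 1"
proof -
  have lim0: "((((\<lambda>\<xi>. - m \<xi>)) \<circ> real_of_ereal) \<longlongrightarrow> - 1) (at_right 0)"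
    using isCont_symbol[of 0]
    by (auto simp: zero_ereal_def ereal_tendsto_simps isCont_def whitham_symbol_def[of 0] filterlim_at_split intro!: tendsto_minus)
  have lim1: "((((\<lambda>\<xi>. - m \<xi>)) \<circ> real_of_ereal) \<longlongrightarrow> 0) (at_left \<infinity>)"
    using tendsto_minus[OF symbol_tendsto_0] by (simp add: ereal_tendsto_simps)
  have der: "((\<lambda>\<xi>. - m \<xi>) has_real_derivative slope \<xi>) (at \<xi>)" if "0 < ereal \<xi>" "ereal \<xi> < \<infinity>" for \<xi>
    using DERIV_minus[OF symbol_has_derivative[of \<xi>]] that by simp
  have cont: "isCont slope \<xi>" if "0 < ereal \<xi>" "ereal \<xi> < \<infinity>" for \<xi>
    using isCont_slope that by simp
  note FTC = interval_integral_FTC_nonneg[of 0 \<infinity>, OF _ der cont _ lim0 lim1]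
  have "set_integrable lborel (einterval 0 \<infinity>) slope" "(LBINT x=0..\<infinity>. slope x) = 0 - - 1"
    by (rule FTC; simp add: slope_nonneg)+
  moreover have "(\<lambda>x. indicator (einterval 0 \<infinity>) x *\<^sub>R slope x) = slope"
    by (auto simp: indicator_def einterval_def slope_def)
  ultimately show ?thesis
    by (simp add: has_bochner_integral_iff set_integrable_def interval_lebesgue_integral_def set_lebesgue_integral_def)
qed

lemma integrable_slope [simp]: "integrable lborel slope" and integral_slope: "(LBINT t. slope t) = 1"
  using has_bochner_integral_slope by (auto simp: has_bochner_integral_iff)

lemma slope_measurable [measurable]: "slope \<in> borel_measurable borel"
  using borel_measurable_integrable[OF integrable_slope] by simp

lemma integrable_slope_mult:
  assumes [measurable]: "h \<in> borel_measurable borel" and "\<And>t. \<bar>h t\<bar> \<le> B"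
  shows "integrable lborel (\<lambda>t. slope t * h t)"
proof (rule Bochner_Integration.integrable_bound)
  show "integrable lborel (\<lambda>t. B * slope t)" by simp
  show "AE t in lborel. norm (slope t * h t) \<le> norm (B * slope t)"
  proof (intro AE_I2)
    fix t show "norm (slope t * h t) \<le> norm (B * slope t)"
      using assms(2)[of t] slope_nonneg[of t]
      by (simp add: abs_mult mult.commute[of B] mult_left_mono order.trans[OF _ abs_ge_self])
  qed
qed simp

lemma symbol_integrate_by_parts:
  assumes R: "0 \<le> R" and G0: "G 0 = 0"
    and deriv: "\<And>x. (G has_real_derivative g x) (at x)" and cont: "continuous_on UNIV g"
  shows "(LBINT \<xi>:{0..R}. m \<xi> * g \<xi>) = m R * G R + (LBINT \<xi>:{0..R}. slope \<xi> * G \<xi>)"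
proof -
  have contG: "continuous_on UNIV G"
    using deriv by (meson DERIV_continuous_on has_field_derivative_at_within)
  have [measurable]: "G \<in> borel_measurable borel" "g \<in> borel_measurable borel"
    using contG cont by (auto intro: borel_measurable_continuous_onI)
  have "compact (G ` {0..R})"
    by (intro compact_continuous_image continuous_on_subset[OF contG]) auto
  then obtain B where B: "\<And>x. x \<in> {0..R} \<Longrightarrow> \<bar>G x\<bar> \<le> B"
    by (force simp: bounded_iff dest!: compact_imp_bounded)
  have "\<bar>indicator {0..R} x * G x\<bar> \<le> max B 0" for x
    using B[of x] by (auto simp: indicator_def)
  then have "integrable lborel (\<lambda>t. slope t * (indicator {0..R} t * G t))"
    by (intro integrable_slope_mult) auto
  then have iD: "set_integrable lborel {0..R} (\<lambda>\<xi>. slope \<xi> * G \<xi>)"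
    by (simp add: set_integrable_def mult_ac)
  have im: "set_integrable lborel {0..R} (\<lambda>\<xi>. m \<xi> * g \<xi>)"
    by (intro borel_integrable_atLeastAtMost' continuous_intros continuous_on_symbol continuous_on_subset[OF cont]) auto
  have "((\<lambda>\<xi>. m \<xi> * g \<xi> - slope \<xi> * G \<xi>) has_integral m R * G R - m 0 * G 0) {0..R}"
  proof (rule fundamental_theorem_of_calculus_interior[OF R])
    show "continuous_on {0..R} (\<lambda>x. m x * G x)"
      by (intro continuous_intros continuous_on_symbol continuous_on_subset[OF contG]) auto
    fix x assume x: "x \<in> {0<..<R}"
    have "((\<lambda>x. m x * G x) has_real_derivative m x * g x - slope x * G x) (at x)"
      using x by (auto intro!: derivative_eq_intros symbol_has_derivative deriv)
    then show "((\<lambda>x. m x * G x) has_vector_derivative m x * g x - slope x * G x) (at x)"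
      by (simp add: has_real_derivative_iff_has_vector_derivative)
  qed
  moreover have "((\<lambda>\<xi>. m \<xi> * g \<xi> - slope \<xi> * G \<xi>) has_integral
      (LBINT \<xi>:{0..R}. m \<xi> * g \<xi>) - (LBINT \<xi>:{0..R}. slope \<xi> * G \<xi>)) {0..R}"
    using has_integral_set_lebesgue im iD set_borel_integral_eq_integral
    by (intro has_integral_diff) (simp_all add: has_integral_iff set_borel_integral_eq_integral)
  ultimately show ?thesis using G0 by (auto dest: has_integral_unique)
qed

text \<open>
  The common source of the kernel formula and of its Fejer-averaged version. Integration by parts
  trades the symbol, which decays too slowly to be integrable, for its integrable \<open>slope\<close>: the new
  integrals converge by domination, and the boundary term is at most a multiple of \<open>m R\<close>.
\<close>
lemma symbol_integral_limit:
  fixes G g :: "real \<Rightarrow> real \<Rightarrow> real"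
  assumes G0: "\<And>R. G R 0 = 0"
    and deriv: "\<And>R x. (G R has_real_derivative g R x) (at x)" and cont: "\<And>R. continuous_on UNIV (g R)"
    and bound: "\<And>R t. 1 \<le> R \<Longrightarrow> 0 \<le> t \<Longrightarrow> t \<le> R \<Longrightarrow> \<bar>G R t\<bar> \<le> B"
    and lim: "\<And>t. ((\<lambda>R. G R t) \<longlongrightarrow> H t) at_top"
    and [measurable]: "H \<in> borel_measurable borel"
  shows "((\<lambda>R. LBINT \<xi>:{0..R}. m \<xi> * g R \<xi>) \<longlongrightarrow> (LBINT t. slope t * H t)) at_top"
proof -
  have [measurable]: "G R \<in> borel_measurable borel" for R
    using deriv by (intro borel_measurable_continuous_onI) (meson DERIV_continuous_on has_field_derivative_at_within)
  have "((\<lambda>R. m R * G R R) \<longlongrightarrow> 0) at_top"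
  proof (rule Lim_null_comparison)
    show "((\<lambda>R. m R * B) \<longlongrightarrow> 0) at_top"
      using tendsto_mult_right[OF symbol_tendsto_0, of B] by simp
    show "\<forall>\<^sub>F R in at_top. norm (m R * G R R) \<le> m R * B"
      using eventually_ge_at_top[of 1]
    proof eventually_elim
      case (elim R)
      then show ?case using bound[of R R] symbol_pos[of R] by (simp add: abs_mult)
    qed
  qed
  moreover have "((\<lambda>R. LBINT \<xi>:{0..R}. slope \<xi> * G R \<xi>) \<longlongrightarrow> (LBINT t. slope t * H t)) at_top"
    unfolding set_lebesgue_integral_def
  proof (rule integral_dominated_convergence_at_top)
    show "integrable lborel (\<lambda>t. B * slope t)" by simp
    show "\<forall>\<^sub>F R in at_top. AE x in lborel. norm (indicator {0..R} x *\<^sub>R (slope x * G R x)) \<le> B * slope x"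
      using eventually_ge_at_top[of 1]
    proof eventually_elim
      case (elim R)
      have "0 \<le> B" using bound[of 1 0] by simp
      then show ?case using bound[OF elim] slope_nonneg
        by (auto simp: indicator_def abs_mult mult.commute[of _ "slope _"] intro!: mult_left_mono)
    qed
    show "AE x in lborel. ((\<lambda>R. indicator {0..R} x *\<^sub>R (slope x * G R x)) \<longlongrightarrow> slope x * H x) at_top"
    proof (intro AE_I2)
      fix x :: real
      show "((\<lambda>R. indicator {0..R} x *\<^sub>R (slope x * G R x)) \<longlongrightarrow> slope x * H x) at_top"
      proof (cases "x \<le> 0")
        case False
        have "((\<lambda>R. slope x * G R x) \<longlongrightarrow> slope x * H x) at_top"
          by (intro tendsto_mult tendsto_const lim)
        then show ?thesis
        proof (rule Lim_transform_eventually)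
          show "\<forall>\<^sub>F R in at_top. slope x * G R x = indicator {0..R} x *\<^sub>R (slope x * G R x)"
            using eventually_ge_at_top[of x] by eventually_elim (use False in simp)
        qed
      qed (simp add: slope_def)
    qed
  qed auto
  ultimately have "((\<lambda>R. m R * G R R + (LBINT \<xi>:{0..R}. slope \<xi> * G R \<xi>)) \<longlongrightarrow> 0 + (LBINT t. slope t * H t)) at_top"
    by (rule tendsto_add)
  then have "((\<lambda>R. m R * G R R + (LBINT \<xi>:{0..R}. slope \<xi> * G R \<xi>)) \<longlongrightarrow> (LBINT t. slope t * H t)) at_top"
    by simp
  then show ?thesis
  proof (rule Lim_transform_eventually)
    show "\<forall>\<^sub>F R in at_top. m R * G R R + (LBINT \<xi>:{0..R}. slope \<xi> * G R \<xi>) = (LBINT \<xi>:{0..R}. m \<xi> * g R \<xi>)"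
      using eventually_ge_at_top[of 0]
      by eventually_elim (simp add: symbol_integrate_by_parts[of _ "G _" "g _", OF _ G0 deriv cont])
  qed
qed

section \<open>Lebesgue integrals on the line\<close>

lemma lborel_integral_reflect:
  fixes f :: "real \<Rightarrow> 'a :: {banach, second_countable_topology}"
  shows "(LBINT x. f (- x)) = (LBINT x. f x)"
  using lborel_integral_real_affine[of "-1" f 0] by simp

lemma lborel_integrable_reflect:
  fixes f :: "real \<Rightarrow> 'a :: {banach, second_countable_topology}"
  shows "integrable lborel f \<Longrightarrow> integrable lborel (\<lambda>x. f (- x))"
  using lborel_integrable_real_affine[of f "-1" 0] by simp

lemma lborel_integral_odd:
  fixes f :: "real \<Rightarrow> real"
  assumes "\<And>x. f (- x) = - f x"
  shows "(LBINT x. f x) = 0"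
  using lborel_integral_reflect[of f] by (simp add: assms)

text \<open>
  Away from the null set \<open>{0}\<close> an even function is the sum of its right half and the reflection of
  that half.
\<close>
lemma has_bochner_integral_even:
  fixes f :: "real \<Rightarrow> real"
  assumes even: "\<And>x. f (- x) = f x" and half: "has_bochner_integral lborel (\<lambda>x. indicator {0<..} x * f x) I"
    and [measurable]: "f \<in> borel_measurable borel"
  shows "has_bochner_integral lborel f (2 * I)"
proof -
  let ?h = "\<lambda>x. indicator {0<..} x * f x"
  have h: "integrable lborel ?h" "integral\<^sup>L lborel ?h = I"
    using half by (auto simp: has_bochner_integral_iff)
  have "has_bochner_integral lborel (\<lambda>x. ?h x + ?h (- x)) (I + I)"
    using h lborel_integrable_reflect[OF h(1)] lborel_integral_reflect[of ?h]
    by (intro has_bochner_integral_add) (auto simp: has_bochner_integral_iff)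
  moreover have "AE x in lborel. ?h x + ?h (- x) = f x"
    using AE_lborel_singleton[of 0] by eventually_elim (auto simp: even indicator_def)
  ultimately have "has_bochner_integral lborel f (I + I)"
    by (subst (asm) has_bochner_integral_cong_AE) auto
  then show ?thesis by simp
qed

lemma set_integral_even:
  fixes f :: "real \<Rightarrow> real"
  assumes even: "\<And>x. f (- x) = f x" and int: "set_integrable lborel {0..R} f"
    and [measurable]: "f \<in> borel_measurable borel"
  shows "(LBINT x:{-R..R}. f x) = 2 * (LBINT x:{0..R}. f x)"
proof -
  have "has_bochner_integral lborel (\<lambda>x. indicator {0..R} x * f x) (LBINT x:{0..R}. f x)"
    using int by (simp add: has_bochner_integral_iff set_integrable_def set_lebesgue_integral_def)
  moreover have "AE x in lborel. indicator {0..R} x * f x = indicator {0<..} x * (indicator {-R..R} x * f x)"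
    using AE_lborel_singleton[of 0] by eventually_elim (auto simp: indicator_def)
  ultimately have "has_bochner_integral lborel (\<lambda>x. indicator {0<..} x * (indicator {-R..R} x * f x)) (LBINT x:{0..R}. f x)"
    by (subst (asm) has_bochner_integral_cong_AE) auto
  then have "has_bochner_integral lborel (\<lambda>x. indicator {-R..R} x * f x) (2 * (LBINT x:{0..R}. f x))"
    by (intro has_bochner_integral_even) (auto simp: even indicator_def)
  then show ?thesis
    by (auto simp: set_lebesgue_integral_def dest: has_bochner_integral_integral_eq)
qed

lemma lborel_integrable_product:
  fixes p q :: "real \<Rightarrow> real"
  assumes p: "integrable lborel p" and q: "integrable lborel q"
  shows "integrable (lborel \<Otimes>\<^sub>M lborel) (\<lambda>(x, y). p x * q y)"
proof -
  have [measurable]: "p \<in> borel_measurable borel" "q \<in> borel_measurable borel"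
    using p q by (auto dest: borel_measurable_integrable)
  show ?thesis
    by (rule lborel_pair.Fubini_integrable) (use p q in \<open>auto simp: abs_mult\<close>)
qed

section \<open>The kernel as a sine transform\<close>

text \<open>
  The sine part of the exponential is odd and integrates to zero, so the truncated Fourier integrals
  are real.
\<close>
lemma truncated_kernel_eq:
  "(CLBINT \<xi>:{-R..R}. of_real (m \<xi>) * exp (\<i> * of_real x * of_real \<xi>)) =
     of_real (2 * (LBINT \<xi>:{0..R}. m \<xi> * cos (x * \<xi>)))" (is "?C = _")
proof -
  let ?f = "\<lambda>\<xi>. indicator {-R..R} \<xi> *\<^sub>R (of_real (m \<xi>) * exp (\<i> * of_real x * of_real \<xi>) :: complex)"
  have "set_integrable lborel {-R..R} (\<lambda>\<xi>. of_real (m \<xi>) * exp (\<i> * of_real x * of_real \<xi>) :: complex)"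
    by (intro borel_integrable_atLeastAtMost' continuous_intros continuous_on_symbol)
  then have int: "integrable lborel ?f" by (simp add: set_integrable_def)
  have e: "exp (\<i> * of_real x * of_real \<xi>) = cis (x * \<xi>)" for \<xi>
    by (simp add: cis_conv_exp mult.assoc)
  have C: "?C = integral\<^sup>L lborel ?f" by (simp add: set_lebesgue_integral_def)
  have "Re ?C = (LBINT \<xi>. Re (?f \<xi>))" unfolding C using int by (rule integral_Re[symmetric])
  also have "\<dots> = (LBINT \<xi>:{-R..R}. m \<xi> * cos (x * \<xi>))"
    by (simp add: e set_lebesgue_integral_def)
  also have "\<dots> = 2 * (LBINT \<xi>:{0..R}. m \<xi> * cos (x * \<xi>))"
    by (intro set_integral_even borel_integrable_atLeastAtMost' continuous_intros continuous_on_symbol) auto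
  finally have "Re ?C = 2 * (LBINT \<xi>:{0..R}. m \<xi> * cos (x * \<xi>))" .
  moreover have "Im ?C = (LBINT \<xi>. Im (?f \<xi>))" unfolding C using int by (rule integral_Im[symmetric])
  then have "Im ?C = 0"
    by (simp add: e) (rule lborel_integral_odd, auto simp: indicator_def)
  ultimately show ?thesis by (simp add: complex_eq_iff)
qed

lemma kernel_eq:
  assumes "x \<noteq> 0"
  shows "whitham_kernel x = 1 / pi * (LBINT t. slope t * (sin (x * t) / x))"
proof -
  have "((\<lambda>R. LBINT \<xi>:{0..R}. m \<xi> * cos (x * \<xi>)) \<longlongrightarrow> (LBINT t. slope t * (sin (x * t) / x))) at_top"
  proof (rule symbol_integral_limit[where G = "\<lambda>R \<xi>. sin (x * \<xi>) / x" and B = "1 / \<bar>x\<bar>"])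
    show "((\<lambda>\<xi>. sin (x * \<xi>) / x) has_real_derivative cos (x * t)) (at t)" for t
      using assms by (auto intro!: derivative_eq_intros)
    show "\<bar>sin (x * t) / x\<bar> \<le> 1 / \<bar>x\<bar>" for t by (simp add: abs_divide divide_right_mono)
  qed (auto intro!: continuous_intros)
  then have "((\<lambda>R. of_real (2 * (LBINT \<xi>:{0..R}. m \<xi> * cos (x * \<xi>))) :: complex) \<longlongrightarrow>
      of_real (2 * (LBINT t. slope t * (sin (x * t) / x)))) at_top"
    by (intro tendsto_of_real tendsto_mult tendsto_const)
  then have "Lim at_top (\<lambda>R::real. CLBINT \<xi>:{-R..R}. of_real (m \<xi>) * exp (\<i> * of_real x * of_real \<xi>)) =
      of_real (2 * (LBINT t. slope t * (sin (x * t) / x)))"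
    unfolding truncated_kernel_eq by (intro tendsto_Lim) auto
  then show ?thesis unfolding whitham_kernel_def by simp
qed

lemma kernel_even: "whitham_kernel (- x) = whitham_kernel x"
  by (cases "x = 0") (simp_all add: kernel_eq)

lemma kernel_measurable [measurable]: "whitham_kernel \<in> borel_measurable borel"
proof -
  have "(\<lambda>x. if x = 0 then whitham_kernel 0 else 1 / pi * (LBINT t. slope t * (sin (x * t) / x))) \<in> borel_measurable borel"
    by measurable
  also have "(\<lambda>x. if x = 0 then whitham_kernel 0 else 1 / pi * (LBINT t. slope t * (sin (x * t) / x))) = whitham_kernel"
    by (auto simp: kernel_eq)
  finally show ?thesis .
qed

section \<open>Positivity of the kernel\<close>

text \<open>
  The triangular weight on \<open>[-R, R]\<close>, whose Fourier transform is the nonnegative Fejer kernel.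
\<close>
definition fejer :: "real \<Rightarrow> real \<Rightarrow> real" where
  "fejer R \<xi> = indicator {-R..R} \<xi> * (1 - \<bar>\<xi>\<bar> / R)"

text \<open>
  The last condition says that the Cesaro means of the truncated Fourier integrals of \<open>f\<close> up to \<open>R\<close>
  are nonnegative, and stands in for positive definiteness of \<open>f\<close>. With the Fejer weight all integrals
  converge absolutely, and the closure properties below follow from Fubini and dominated convergence,
  without measures that have \<open>f\<close> as their Fourier transform.
\<close>
definition fejer_positive :: "real \<Rightarrow> (real \<Rightarrow> real) \<Rightarrow> bool" where
  "fejer_positive R f \<longleftrightarrow> f \<in> borel_measurable borel \<and> (\<exists>B. \<forall>\<xi>. \<bar>f \<xi>\<bar> \<le> B) \<and>
     (\<forall>x. 0 \<le> (LBINT \<xi>. fejer R \<xi> * (f \<xi> * cos (x * \<xi>))))"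

lemma fejer_nonneg: "0 \<le> fejer R \<xi>"
  by (auto simp: fejer_def indicator_def divide_le_eq_1)

lemma fejer_measurable [measurable]: "fejer R \<in> borel_measurable borel"
  unfolding fejer_def by measurable

lemma integrable_fejer: "integrable lborel (fejer R)"
proof -
  have "set_integrable lborel {-R..R} (\<lambda>\<xi>. 1 - \<bar>\<xi>\<bar> * inverse R)"
    by (intro borel_integrable_atLeastAtMost' continuous_intros)
  then show ?thesis by (simp add: set_integrable_def fejer_def[abs_def] divide_inverse)
qed

lemma integrable_fejer_mult:
  assumes [measurable]: "f \<in> borel_measurable borel" and "\<And>\<xi>. \<bar>f \<xi>\<bar> \<le> B"
  shows "integrable lborel (\<lambda>\<xi>. fejer R \<xi> * (f \<xi> * cos (x * \<xi>)))"
proof (rule Bochner_Integration.integrable_bound)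
  show "integrable lborel (\<lambda>\<xi>. fejer R \<xi> * B)" using integrable_fejer by simp
  show "AE \<xi> in lborel. norm (fejer R \<xi> * (f \<xi> * cos (x * \<xi>))) \<le> norm (fejer R \<xi> * B)"
  proof (intro AE_I2)
    fix \<xi>
    have "\<bar>f \<xi>\<bar> * \<bar>cos (x * \<xi>)\<bar> \<le> B * 1"
      using assms(2)[of \<xi>] by (intro mult_mono) auto
    then show "norm (fejer R \<xi> * (f \<xi> * cos (x * \<xi>))) \<le> norm (fejer R \<xi> * B)"
      using fejer_nonneg[of R \<xi>] by (simp add: abs_mult mult_left_mono)
  qed
qed measurable

lemma integrable_fejer_positive:
  "fejer_positive R f \<Longrightarrow> integrable lborel (\<lambda>\<xi>. fejer R \<xi> * (f \<xi> * cos (x * \<xi>)))"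
  using integrable_fejer_mult unfolding fejer_positive_def by blast

text \<open>
  The antiderivative of \<open>(1 - \<xi> / R) * cos (x * \<xi>)\<close> that vanishes at 0; as \<open>R\<close> tends to infinity it
  converges to the antiderivative \<open>sin (x * \<xi>) / x\<close> of \<open>cos (x * \<xi>)\<close>.
\<close>
definition fejer_cos :: "real \<Rightarrow> real \<Rightarrow> real \<Rightarrow> real" where
  "fejer_cos x R \<xi> = (1 - \<xi> / R) * (sin (x * \<xi>) / x) + (1 - cos (x * \<xi>)) / (R * x\<^sup>2)"

lemma fejer_cos_deriv:
  assumes "x \<noteq> 0"
  shows "(fejer_cos x R has_real_derivative (1 - \<xi> / R) * cos (x * \<xi>)) (at \<xi>)"
proof -
  have "(fejer_cos x R has_real_derivative
     (- (1 / R)) * (sin (x * \<xi>) / x) + (1 - \<xi> / R) * (cos (x * \<xi>) * x / x) + (sin (x * \<xi>) * x) / (R * x\<^sup>2)) (at \<xi>)"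
    unfolding fejer_cos_def[abs_def] divide_inverse
    by (auto intro!: derivative_eq_intros)
  also have "(- (1 / R)) * (sin (x * \<xi>) / x) + (1 - \<xi> / R) * (cos (x * \<xi>) * x / x) + (sin (x * \<xi>) * x) / (R * x\<^sup>2)
      = (1 - \<xi> / R) * cos (x * \<xi>)"
    using assms by (simp add: power2_eq_square)
  finally show ?thesis .
qed

lemma fejer_integral_even:
  assumes cont: "continuous_on UNIV f" and even: "\<And>\<xi>. f (- \<xi>) = f \<xi>" and "0 < R"
  shows "(LBINT \<xi>. fejer R \<xi> * (f \<xi> * cos (x * \<xi>))) = 2 * (LBINT \<xi>:{0..R}. f \<xi> * ((1 - \<xi> / R) * cos (x * \<xi>)))"
proof -
  have [measurable]: "f \<in> borel_measurable borel" using cont by (rule borel_measurable_continuous_onI)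
  let ?h = "\<lambda>\<xi>. f \<xi> * ((1 - \<bar>\<xi>\<bar> / R) * cos (x * \<xi>))"
  have "(LBINT \<xi>. fejer R \<xi> * (f \<xi> * cos (x * \<xi>))) = (LBINT \<xi>:{-R..R}. ?h \<xi>)"
    by (simp add: set_lebesgue_integral_def fejer_def mult_ac)
  also have "\<dots> = 2 * (LBINT \<xi>:{0..R}. ?h \<xi>)"
    using \<open>0 < R\<close> by (intro set_integral_even borel_integrable_atLeastAtMost' continuous_intros continuous_on_subset[OF cont])
       (auto simp: even)
  also have "(LBINT \<xi>:{0..R}. ?h \<xi>) = (LBINT \<xi>:{0..R}. f \<xi> * ((1 - \<xi> / R) * cos (x * \<xi>)))"
    by (intro set_lebesgue_integral_cong) auto
  finally show ?thesis .
qed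

text \<open>
  For \<open>x \<noteq> 0\<close> the integral is the Fejer kernel \<open>2 * (1 - cos (x * R)) / (R * x\<^sup>2)\<close>.
\<close>
lemma fejer_positive_one:
  assumes "0 < R"
  shows "fejer_positive R (\<lambda>_. 1)"
  unfolding fejer_positive_def
proof (intro conjI allI)
  fix x :: real
  show "0 \<le> (LBINT \<xi>. fejer R \<xi> * (1 * cos (x * \<xi>)))"
  proof (cases "x = 0")
    case True
    then show ?thesis using fejer_nonneg by (simp add: integral_nonneg_AE)
  next
    case False
    have "(\<integral>\<xi>. ((1 - \<xi> / R) * cos (x * \<xi>)) * indicator {0..R} \<xi> \<partial>lborel) = fejer_cos x R R - fejer_cos x R 0"
      using assms by (intro integral_FTC_Icc_real fejer_cos_deriv[OF False] continuous_intros) auto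
    also have "\<dots> = (1 - cos (x * R)) / (R * x\<^sup>2)"
      using assms by (simp add: fejer_cos_def)
    also have "\<dots> \<ge> 0" using assms by simp
    finally have "0 \<le> (\<integral>\<xi>. ((1 - \<xi> / R) * cos (x * \<xi>)) * indicator {0..R} \<xi> \<partial>lborel)" .
    then show ?thesis using fejer_integral_even[of "\<lambda>_. 1" R x] assms
      by (simp add: set_lebesgue_integral_def mult.commute)
  qed
qed auto

lemma fejer_positive_add:
  assumes f: "fejer_positive R f" and g: "fejer_positive R g"
  shows "fejer_positive R (\<lambda>\<xi>. f \<xi> + g \<xi>)"
proof -
  from f g have [measurable]: "f \<in> borel_measurable borel" "g \<in> borel_measurable borel"
    by (auto simp: fejer_positive_def)
  from f g obtain A B where "\<And>\<xi>. \<bar>f \<xi>\<bar> \<le> A" "\<And>\<xi>. \<bar>g \<xi>\<bar> \<le> B" by (auto simp: fejer_positive_def)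
  then have "\<bar>f \<xi> + g \<xi>\<bar> \<le> A + B" for \<xi> by (meson abs_triangle_ineq add_mono order.trans)
  moreover have "0 \<le> (LBINT \<xi>. fejer R \<xi> * ((f \<xi> + g \<xi>) * cos (x * \<xi>)))" for x
    using f g by (simp add: distrib_left distrib_right integrable_fejer_positive) (simp add: fejer_positive_def)
  ultimately show ?thesis unfolding fejer_positive_def by auto
qed

lemma fejer_positive_cmult:
  assumes f: "fejer_positive R f" and "0 \<le> c"
  shows "fejer_positive R (\<lambda>\<xi>. c * f \<xi>)"
proof -
  from f obtain B where "\<And>\<xi>. \<bar>f \<xi>\<bar> \<le> B" by (auto simp: fejer_positive_def)
  then have "\<bar>c * f \<xi>\<bar> \<le> c * B" for \<xi> using \<open>0 \<le> c\<close> by (simp add: abs_mult mult_left_mono)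
  moreover have "(LBINT \<xi>. fejer R \<xi> * (c * f \<xi> * cos (x * \<xi>))) = c * (LBINT \<xi>. fejer R \<xi> * (f \<xi> * cos (x * \<xi>)))" for x
    by (simp add: mult_ac flip: integral_mult_right_zero)
  ultimately show ?thesis using f \<open>0 \<le> c\<close> unfolding fejer_positive_def by auto
qed

lemma fejer_positive_sum:
  assumes "0 < R" "\<And>i. i \<in> I \<Longrightarrow> fejer_positive R (f i)"
  shows "fejer_positive R (\<lambda>\<xi>. \<Sum>i\<in>I. f i \<xi>)"
proof -
  have 0: "fejer_positive R (\<lambda>_. 0)" by (auto simp: fejer_positive_def)
  show ?thesis using assms(2)
    by (induction I rule: infinite_finite_induct) (auto intro: fejer_positive_add 0)
qed

lemma fejer_positive_limit:
  assumes pos: "\<And>n. fejer_positive R (f n)" and lim: "\<And>\<xi>. (\<lambda>n. f n \<xi>) \<longlonglongrightarrow> g \<xi>" and B: "\<And>n \<xi>. \<bar>f n \<xi>\<bar> \<le> B"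
  shows "fejer_positive R g"
proof -
  have f [measurable]: "f n \<in> borel_measurable borel" for n using pos by (auto simp: fejer_positive_def)
  have g [measurable]: "g \<in> borel_measurable borel"
    by (rule borel_measurable_LIMSEQ_real[OF lim]) auto
  have gB: "\<bar>g \<xi>\<bar> \<le> B" for \<xi>
    by (rule LIMSEQ_le_const2[OF tendsto_rabs[OF lim]]) (use B in auto)
  have "0 \<le> (LBINT \<xi>. fejer R \<xi> * (g \<xi> * cos (x * \<xi>)))" for x
  proof (rule LIMSEQ_le_const)
    show "(\<lambda>n. LBINT \<xi>. fejer R \<xi> * (f n \<xi> * cos (x * \<xi>))) \<longlonglongrightarrow> (LBINT \<xi>. fejer R \<xi> * (g \<xi> * cos (x * \<xi>)))"
    proof (rule integral_dominated_convergence)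
      show "integrable lborel (\<lambda>\<xi>. fejer R \<xi> * B)" using integrable_fejer by simp
      show "AE \<xi> in lborel. norm (fejer R \<xi> * (f n \<xi> * cos (x * \<xi>))) \<le> fejer R \<xi> * B" for n
      proof (intro AE_I2)
        fix \<xi>
        have "\<bar>f n \<xi>\<bar> * \<bar>cos (x * \<xi>)\<bar> \<le> B * 1"
          using B[of n \<xi>] by (intro mult_mono) auto
        then show "norm (fejer R \<xi> * (f n \<xi> * cos (x * \<xi>))) \<le> fejer R \<xi> * B"
          using fejer_nonneg[of R \<xi>] by (simp add: abs_mult mult_left_mono)
      qed
      show "AE \<xi> in lborel. (\<lambda>n. fejer R \<xi> * (f n \<xi> * cos (x * \<xi>))) \<longlonglongrightarrow> fejer R \<xi> * (g \<xi> * cos (x * \<xi>))"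
        by (intro AE_I2 tendsto_intros lim)
    qed measurable
    show "\<exists>N. \<forall>n\<ge>N. 0 \<le> (LBINT \<xi>. fejer R \<xi> * (f n \<xi> * cos (x * \<xi>)))"
      using pos by (auto simp: fejer_positive_def)
  qed
  then show ?thesis using gB g unfolding fejer_positive_def by blast
qed

text \<open>
  The right half of the Fourier transform of the Laplace density; the antiderivative \<open>?F\<close> is the real
  part of \<open>exp ((\<i> * \<xi> - c) * y) / (\<i> * \<xi> - c)\<close>.
\<close>
lemma cosine_transform_exp:
  fixes c :: real assumes c: "0 < c"
  shows "has_bochner_integral lborel (\<lambda>y. indicator {0<..} y * (exp (- (y * c)) * cos (\<xi> * y))) (c / (c\<^sup>2 + \<xi>\<^sup>2))"
proof -
  let ?F = "\<lambda>y. exp (- (y * c)) * (\<xi> * sin (\<xi> * y) - c * cos (\<xi> * y)) / (c\<^sup>2 + \<xi>\<^sup>2)"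
  let ?f = "\<lambda>y. exp (- (y * c)) * cos (\<xi> * y)"
  have pos: "c\<^sup>2 + \<xi>\<^sup>2 > 0" using c by (simp add: add_pos_nonneg)
  have int: "set_integrable lborel {0<..} ?f"
    unfolding set_integrable_def
  proof (rule Bochner_Integration.integrable_bound)
    show "integrable lborel (\<lambda>y. indicator {0<..} y *\<^sub>R exp (- (y * c)))"
      using integrable_I0i_exp_mscale[OF c] by (simp add: set_integrable_def)
    show "AE x in lborel. norm (indicator {0<..} x *\<^sub>R ?f x) \<le> norm (indicator {0<..} x *\<^sub>R exp (- (x * c)))"
      by (intro AE_I2) (auto simp: indicator_def abs_mult)
  qed measurable
  have E: "einterval 0 \<infinity> = {0::real<..}" by (auto simp: einterval_def)
  have "(LBINT y=0..\<infinity>. ?f y) = 0 - (- c / (c\<^sup>2 + \<xi>\<^sup>2))"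
  proof (rule interval_integral_FTC_integrable[where F = ?F])
    show "(?F has_vector_derivative ?f y) (at y)" for y
    proof -
      have "(?F has_real_derivative
         (exp (- (y * c)) * (- c) * (\<xi> * sin (\<xi> * y) - c * cos (\<xi> * y))
          + exp (- (y * c)) * (\<xi> * (cos (\<xi> * y) * \<xi>) + c * (sin (\<xi> * y) * \<xi>))) / (c\<^sup>2 + \<xi>\<^sup>2)) (at y)"
        using pos by (auto intro!: derivative_eq_intros)
      also have "(exp (- (y * c)) * (- c) * (\<xi> * sin (\<xi> * y) - c * cos (\<xi> * y))
          + exp (- (y * c)) * (\<xi> * (cos (\<xi> * y) * \<xi>) + c * (sin (\<xi> * y) * \<xi>))) = ?f y * (c\<^sup>2 + \<xi>\<^sup>2)"
        by (simp add: algebra_simps power2_eq_square)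
      finally show ?thesis using c by (simp add: has_real_derivative_iff_has_vector_derivative)
    qed
    show "set_integrable lborel (einterval 0 \<infinity>) ?f" unfolding E by (rule int)
    have "isCont ?F 0" using pos by (intro continuous_intros) auto
    then have "(?F \<longlongrightarrow> - c / (c\<^sup>2 + \<xi>\<^sup>2)) (at_right 0)"
      by (auto simp: isCont_def filterlim_at_split)
    then show "((?F \<circ> real_of_ereal) \<longlongrightarrow> - c / (c\<^sup>2 + \<xi>\<^sup>2)) (at_right 0)"
      by (simp add: zero_ereal_def ereal_tendsto_simps)
    have "(?F \<longlongrightarrow> 0) at_top"
    proof (rule Lim_null_comparison)
      show "((\<lambda>y. exp (- (y * c)) * ((\<bar>\<xi>\<bar> + c) / (c\<^sup>2 + \<xi>\<^sup>2))) \<longlongrightarrow> 0) at_top"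
      proof -
        have "((\<lambda>y. exp (- (y * c))) \<longlongrightarrow> 0) at_top" using c by real_asymp
        from tendsto_mult_left_zero[OF this] show ?thesis .
      qed
      show "\<forall>\<^sub>F y in at_top. norm (?F y) \<le> exp (- (y * c)) * ((\<bar>\<xi>\<bar> + c) / (c\<^sup>2 + \<xi>\<^sup>2))"
      proof (intro always_eventually allI)
        fix y
        have "\<bar>\<xi> * sin (\<xi> * y) - c * cos (\<xi> * y)\<bar> \<le> \<bar>\<xi>\<bar> * \<bar>sin (\<xi> * y)\<bar> + c * \<bar>cos (\<xi> * y)\<bar>"
          using c by (intro order.trans[OF abs_triangle_ineq4]) (simp add: abs_mult)
        also have "\<dots> \<le> \<bar>\<xi>\<bar> * 1 + c * 1"
          using c by (intro add_mono mult_left_mono) auto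
        finally show "norm (?F y) \<le> exp (- (y * c)) * ((\<bar>\<xi>\<bar> + c) / (c\<^sup>2 + \<xi>\<^sup>2))"
          using pos by (simp add: abs_mult divide_right_mono)
      qed
    qed
    then show "((?F \<circ> real_of_ereal) \<longlongrightarrow> 0) (at_left \<infinity>)"
      by (simp add: ereal_tendsto_simps)
  qed (auto intro!: continuous_intros)
  then show ?thesis using int
    by (simp add: has_bochner_integral_iff set_integrable_def set_lebesgue_integral_def
        interval_lebesgue_integral_0_infty)
qed

text \<open>
  The factor \<open>c\<^sup>2 / (c\<^sup>2 + \<xi>\<^sup>2)\<close> is the Fourier transform of the Laplace density
  \<open>c / 2 * exp (- c * \<bar>y\<bar>)\<close>. Multiplying by it therefore averages the Fejer means over their
  translates by \<open>y\<close> and \<open>- y\<close>, with positive weights.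
\<close>
lemma fejer_positive_mult_resolvent:
  assumes f: "fejer_positive R f" and c: "0 < c"
  shows "fejer_positive R (\<lambda>\<xi>. c\<^sup>2 / (c\<^sup>2 + \<xi>\<^sup>2) * f \<xi>)"
proof -
  have fm [measurable]: "f \<in> borel_measurable borel" using f by (simp add: fejer_positive_def)
  from f obtain B where B: "\<And>\<xi>. \<bar>f \<xi>\<bar> \<le> B" by (auto simp: fejer_positive_def)
  have pos: "c\<^sup>2 + \<xi>\<^sup>2 > 0" for \<xi> using c by (simp add: add_pos_nonneg)
  define e where "e y = indicator {0<..} y * (c * exp (- (y * c)))" for y
  have [measurable]: "e \<in> borel_measurable borel" unfolding e_def by measurable
  have e0: "0 \<le> e y" for y using c by (simp add: e_def)
  have "set_integrable lborel {0<..} (\<lambda>y. exp (- (y * c)))"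
    using integrable_I0i_exp_mscale[OF c] .
  then have "integrable lborel (\<lambda>y. c * (indicator {0<..} y *\<^sub>R exp (- (y * c))))"
    unfolding set_integrable_def by simp
  then have e_int: "integrable lborel e" unfolding e_def by (simp add: mult_ac)
  let ?\<Lambda> = "\<lambda>x. LBINT \<xi>. fejer R \<xi> * (f \<xi> * cos (x * \<xi>))"
  have "0 \<le> (LBINT \<xi>. fejer R \<xi> * (c\<^sup>2 / (c\<^sup>2 + \<xi>\<^sup>2) * f \<xi> * cos (x * \<xi>)))" for x
  proof -
    let ?g = "\<lambda>\<xi> y. (fejer R \<xi> * B * e y)"
    \<comment> \<open>Integrating \<open>?h\<close> over \<open>y\<close> first yields the multiplier. Integrating over \<open>\<xi>\<close> first
    yields the translates, because \<open>2 * cos (\<xi> * y) * cos (x * \<xi>) = cos ((x + y) * \<xi>) + cos ((x - y) * \<xi>)\<close>.\<close>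
    let ?h = "\<lambda>\<xi> y. fejer R \<xi> * f \<xi> * (e y * cos (\<xi> * y) * cos (x * \<xi>))"
    have int: "integrable (lborel \<Otimes>\<^sub>M lborel) (case_prod ?h)"
    proof (rule Bochner_Integration.integrable_bound)
      show "integrable (lborel \<Otimes>\<^sub>M lborel) (\<lambda>(\<xi>, y). fejer R \<xi> * B * e y)"
        using integrable_fejer e_int by (intro lborel_integrable_product) auto
      show "AE z in lborel \<Otimes>\<^sub>M lborel. norm (case_prod ?h z) \<le> norm (case z of (\<xi>, y) \<Rightarrow> fejer R \<xi> * B * e y)"
      proof (intro AE_I2, clarify)
        fix \<xi> y :: real
        have "\<bar>f \<xi>\<bar> * (e y * \<bar>cos (\<xi> * y)\<bar> * \<bar>cos (x * \<xi>)\<bar>) \<le> B * (e y * 1 * 1)"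
          using B[of \<xi>] e0[of y] by (intro mult_mono) auto
        then have "fejer R \<xi> * (\<bar>f \<xi>\<bar> * (e y * \<bar>cos (\<xi> * y)\<bar> * \<bar>cos (x * \<xi>)\<bar>)) \<le> fejer R \<xi> * (B * (e y * 1 * 1))"
          using fejer_nonneg by (rule mult_left_mono)
        moreover have "0 \<le> B" using B[of 0] by simp
        ultimately show "norm (?h \<xi> y) \<le> norm (fejer R \<xi> * B * e y)"
          using fejer_nonneg[of R \<xi>] e0[of y] by (simp add: abs_mult mult_ac)
      qed
    qed measurable
    have inner1: "(LBINT y. ?h \<xi> y) = fejer R \<xi> * (c\<^sup>2 / (c\<^sup>2 + \<xi>\<^sup>2) * f \<xi> * cos (x * \<xi>))" for \<xi>
    proof -
      have "(LBINT y. ?h \<xi> y) = (LBINT y. (fejer R \<xi> * f \<xi> * c * cos (x * \<xi>)) * (indicator {0<..} y * (exp (- (y * c)) * cos (\<xi> * y))))"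
        by (simp add: e_def mult_ac)
      also have "\<dots> = (fejer R \<xi> * f \<xi> * c * cos (x * \<xi>)) * (c / (c\<^sup>2 + \<xi>\<^sup>2))"
        using cosine_transform_exp[OF c, of \<xi>] by (simp only: integral_mult_right_zero has_bochner_integral_integral_eq)
      finally show ?thesis by (simp add: power2_eq_square mult_ac)
    qed
    have inner2: "(LBINT \<xi>. ?h \<xi> y) = e y / 2 * (?\<Lambda> (x + y) + ?\<Lambda> (x - y))" for y
    proof -
      have "?h \<xi> y = e y / 2 * (fejer R \<xi> * (f \<xi> * cos ((x + y) * \<xi>)) + fejer R \<xi> * (f \<xi> * cos ((x - y) * \<xi>)))" for \<xi>
        by (simp add: cos_add cos_diff algebra_simps)
      then show ?thesis
        using f by (simp only: integral_mult_right_zero Bochner_Integration.integral_add integrable_fejer_positive)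
    qed
    have "(LBINT \<xi>. LBINT y. ?h \<xi> y) = (LBINT y. LBINT \<xi>. ?h \<xi> y)"
      by (rule lborel_pair.Fubini_integral[OF int, symmetric])
    also have "\<dots> \<ge> 0"
      unfolding inner2
    proof (intro integral_nonneg_AE AE_I2)
      fix y
      have "0 \<le> ?\<Lambda> (x + y)" "0 \<le> ?\<Lambda> (x - y)" using f by (auto simp: fejer_positive_def)
      then show "0 \<le> e y / 2 * (?\<Lambda> (x + y) + ?\<Lambda> (x - y))"
        using e0[of y] by (intro mult_nonneg_nonneg add_nonneg_nonneg) auto
    qed
    finally show ?thesis unfolding inner1 .
  qed
  moreover have "\<bar>c\<^sup>2 / (c\<^sup>2 + \<xi>\<^sup>2) * f \<xi>\<bar> \<le> B" for \<xi>
  proof -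
    have "\<bar>c\<^sup>2 / (c\<^sup>2 + \<xi>\<^sup>2)\<bar> * \<bar>f \<xi>\<bar> \<le> 1 * B"
      using pos[of \<xi>] B[of \<xi>] by (intro mult_mono) auto
    then show ?thesis by (simp add: abs_mult)
  qed
  ultimately show ?thesis unfolding fejer_positive_def by auto
qed

text \<open>
  The binomial series of \<open>(1 - s) powr (- (1/2))\<close> has the coefficients
  \<open>pochhammer (1/2) k / fact k\<close>, which are nonnegative. So if multiplication by \<open>S\<close> preserves the
  class, all partial sums of the series in \<open>S / A\<close> belong to it; the gap between \<open>q\<close> and \<open>A\<close> bounds
  them uniformly.
\<close>
lemma fejer_positive_inverse_sqrt:
  assumes R: "0 < R" and S: "\<And>f. fejer_positive R f \<Longrightarrow> fejer_positive R (\<lambda>\<xi>. S \<xi> * f \<xi>)"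
    and bounds: "\<And>\<xi>. 0 \<le> S \<xi>" "\<And>\<xi>. S \<xi> \<le> q" and q: "q < A"
  shows "fejer_positive R (\<lambda>\<xi>. (A - S \<xi>) powr (- (1/2)))"
proof -
  have q0: "0 \<le> q" using bounds[of 0] by linarith
  then have A: "0 < A" using q by simp
  define a where "a k = pochhammer (1/2 :: real) k / fact k" for k
  have a0: "0 \<le> a k" for k by (simp add: a_def pochhammer_nonneg)
  have Spow: "fejer_positive R (\<lambda>\<xi>. S \<xi> ^ k)" for k
  proof (induction k)
    case (Suc k)
    then show ?case using S[of "\<lambda>\<xi>. S \<xi> ^ k"] by simp
  qed (simp add: fejer_positive_one[OF R])
  have series: "(\<lambda>k. a k * (S \<xi> / A) ^ k) sums (1 - S \<xi> / A) powr (- (1/2))" for \<xi>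
  proof -
    have "\<bar>- (S \<xi> / A)\<bar> < 1" using A bounds[of \<xi>] q by (simp add: abs_mult)
    from gen_binomial_real[OF this, of "- (1/2)"]
    have "(\<lambda>k. (- (1/2) gchoose k) * (- (S \<xi> / A)) ^ k) sums (1 - S \<xi> / A) powr (- (1/2))" by simp
    moreover have "(- (1/2) gchoose k) * (- (S \<xi> / A)) ^ k = a k * (S \<xi> / A) ^ k" for k
    proof -
      have "(-1 :: real) ^ k * (-1) ^ k = 1" by (simp flip: power_mult_distrib)
      then show ?thesis
        by (simp add: gbinomial_pochhammer a_def power_minus[of "S \<xi> / A"])
    qed
    ultimately show ?thesis by simp
  qed
  have "fejer_positive R (\<lambda>\<xi>. (1 - S \<xi> / A) powr (- (1/2)))"
  proof (rule fejer_positive_limit)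
    show "fejer_positive R (\<lambda>\<xi>. \<Sum>k<n. a k * (S \<xi> / A) ^ k)" for n
    proof (intro fejer_positive_sum R)
      fix k
      have "fejer_positive R (\<lambda>\<xi>. (a k / A ^ k) * S \<xi> ^ k)"
        using a0 A by (intro fejer_positive_cmult Spow) auto
      then show "fejer_positive R (\<lambda>\<xi>. a k * (S \<xi> / A) ^ k)" by (simp add: power_divide)
    qed
    show "(\<lambda>n. \<Sum>k<n. a k * (S \<xi> / A) ^ k) \<longlonglongrightarrow> (1 - S \<xi> / A) powr (- (1/2))" for \<xi>
      using series[of \<xi>] by (simp add: sums_def)
    show "\<bar>\<Sum>k<n. a k * (S \<xi> / A) ^ k\<bar> \<le> (1 - q / A) powr (- (1/2))" for n \<xi>
    proof -
      have nn: "0 \<le> a k * (S \<xi> / A) ^ k" for k using a0 bounds[of \<xi>] A by simp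
      have "(\<Sum>k<n. a k * (S \<xi> / A) ^ k) \<le> (1 - S \<xi> / A) powr (- (1/2))"
        using sum_le_suminf[OF sums_summable[OF series[of \<xi>]], of "{..<n}"] sums_unique[OF series[of \<xi>]] nn by auto
      also have "\<dots> \<le> (1 - q / A) powr (- (1/2))"
        using A q bounds[of \<xi>] by (intro powr_mono2') (auto simp: divide_right_mono)
      finally show ?thesis using nn by (simp add: sum_nonneg)
    qed
  qed
  then have "fejer_positive R (\<lambda>\<xi>. A powr (- (1/2)) * (1 - S \<xi> / A) powr (- (1/2)))"
    by (rule fejer_positive_cmult) simp
  moreover have "A powr (- (1/2)) * (1 - S \<xi> / A) powr (- (1/2)) = (A - S \<xi>) powr (- (1/2))" for \<xi>
  proof -
    have "A powr (- (1/2)) * (1 - S \<xi> / A) powr (- (1/2)) = (A * (1 - S \<xi> / A)) powr (- (1/2))"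
      by (simp only: powr_mult)
    then show ?thesis using A by (simp add: right_diff_distrib)
  qed
  ultimately show ?thesis by simp
qed

lemma symbol_eq_powr:
  assumes "\<xi> \<noteq> 0" shows "m \<xi> = (\<xi> * cosh \<xi> / sinh \<xi>) powr (- (1/2))"
proof -
  have eq: "\<xi> * cosh \<xi> / sinh \<xi> = inverse (tanh \<xi> / \<xi>)" using assms by (simp add: tanh_def)
  have pos: "0 < tanh \<xi> / \<xi>" using assms by (auto simp: zero_less_divide_iff)
  show ?thesis unfolding eq using assms pos
    by (simp add: whitham_symbol_def powr_minus powr_half_sqrt real_sqrt_inverse del: inverse_divide)
qed

text \<open>
  Each term \<open>2 * \<xi>\<^sup>2 / (\<xi>\<^sup>2 + c\<^sup>2)\<close> of the partial fraction expansion of \<open>\<xi> * coth \<xi> - 1\<close> equals 2 minus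
  a positive multiple of \<open>c\<^sup>2 / (c\<^sup>2 + \<xi>\<^sup>2)\<close>. The truncated expansion thus has the form \<open>A - S\<close> required
  for the inverse square root.
\<close>
lemma fejer_positive_symbol:
  assumes R: "0 < R" shows "fejer_positive R m"
proof -
  define c where "c n = real (Suc n) * pi" for n
  have c: "0 < c n" for n by (simp add: c_def)
  define S where "S N \<xi> = (\<Sum>n<N. 2 * ((c n)\<^sup>2 / ((c n)\<^sup>2 + \<xi>\<^sup>2)))" for N \<xi>
  have pos: "(c n)\<^sup>2 + \<xi>\<^sup>2 > 0" for n \<xi> using c[of n] by (simp add: add_pos_nonneg)
  have split: "2 * ((c n)\<^sup>2 / ((c n)\<^sup>2 + \<xi>\<^sup>2)) = 2 - 2 * \<xi>\<^sup>2 / (\<xi>\<^sup>2 + (c n)\<^sup>2)" for n \<xi>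
  proof -
    have "2 * ((c n)\<^sup>2 / ((c n)\<^sup>2 + \<xi>\<^sup>2)) = (2 * ((c n)\<^sup>2 + \<xi>\<^sup>2) - 2 * \<xi>\<^sup>2) / ((c n)\<^sup>2 + \<xi>\<^sup>2)"
      by simp
    also have "\<dots> = 2 - 2 * \<xi>\<^sup>2 / ((c n)\<^sup>2 + \<xi>\<^sup>2)"
      unfolding diff_divide_distrib
      using pos[of n \<xi>] by (simp only: nonzero_mult_div_cancel_right less_imp_neq[symmetric] not_False_eq_True)
    finally show ?thesis by (simp add: add.commute)
  qed
  have S_eq: "(1 + 2 * real N) - S N \<xi> = 1 + (\<Sum>n<N. 2 * \<xi>\<^sup>2 / (\<xi>\<^sup>2 + (c n)\<^sup>2))" for N \<xi>
    unfolding S_def split by (simp add: sum_subtractf)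
  have ge1: "1 \<le> 1 + 2 * real N - S N \<xi>" for N \<xi>
    unfolding S_eq by (simp add: sum_nonneg)
  show ?thesis
  proof (rule fejer_positive_limit)
    show "fejer_positive R (\<lambda>\<xi>. (1 + 2 * real N - S N \<xi>) powr (- (1/2)))" for N
    proof (rule fejer_positive_inverse_sqrt[OF R, where q = "2 * real N"])
      show "0 \<le> S N \<xi>" for \<xi> by (simp add: S_def sum_nonneg)
      show "S N \<xi> \<le> 2 * real N" for \<xi> using ge1[of N \<xi>] by simp
      fix f assume f: "fejer_positive R f"
      have "fejer_positive R (\<lambda>\<xi>. \<Sum>n<N. 2 * ((c n)\<^sup>2 / ((c n)\<^sup>2 + \<xi>\<^sup>2) * f \<xi>))"
        using f c by (intro fejer_positive_sum R fejer_positive_cmult fejer_positive_mult_resolvent) auto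
      then show "fejer_positive R (\<lambda>\<xi>. S N \<xi> * f \<xi>)"
        by (simp add: S_def sum_distrib_right mult.assoc)
    qed simp
    show "\<bar>(1 + 2 * real N - S N \<xi>) powr (- (1/2))\<bar> \<le> 1" for N \<xi>
      using powr_mono2'[of "- (1/2)" 1 "1 + 2 * real N - S N \<xi>"] ge1[of N \<xi>] by simp
    show "(\<lambda>N. (1 + 2 * real N - S N \<xi>) powr (- (1/2))) \<longlonglongrightarrow> m \<xi>" for \<xi>
    proof (cases "\<xi> = 0")
      case True
      then show ?thesis by (simp add: S_eq whitham_symbol_def)
    next
      case False
      have "(\<lambda>N. 1 + 2 * real N - S N \<xi>) \<longlonglongrightarrow> 1 + (\<xi> * cosh \<xi> / sinh \<xi> - 1)"
        unfolding S_eq c_def by (intro tendsto_add tendsto_const coth_partial_fractions False)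
      then have lim: "(\<lambda>N. 1 + 2 * real N - S N \<xi>) \<longlonglongrightarrow> \<xi> * cosh \<xi> / sinh \<xi>" by simp
      then have "1 \<le> \<xi> * cosh \<xi> / sinh \<xi>"
        by (rule LIMSEQ_le_const) (use ge1 in auto)
      then show ?thesis unfolding symbol_eq_powr[OF False]
        by (intro tendsto_powr lim tendsto_const) auto
    qed
  qed
qed

text \<open>
  The Fejer means of the Fourier integral of \<open>m\<close> are nonnegative, and they have the same limit as its
  symmetric truncations.
\<close>
lemma kernel_nonneg:
  assumes x: "x \<noteq> 0" shows "0 \<le> whitham_kernel x"
proof -
  have "((\<lambda>R. LBINT \<xi>:{0..R}. m \<xi> * ((1 - \<xi> / R) * cos (x * \<xi>))) \<longlongrightarrow> (LBINT t. slope t * (sin (x * t) / x))) at_top"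
  proof (rule symbol_integral_limit[where G = "fejer_cos x" and B = "1 / \<bar>x\<bar> + 2 / x\<^sup>2"])
    show "fejer_cos x R 0 = 0" for R by (simp add: fejer_cos_def)
    show "(fejer_cos x R has_real_derivative (1 - \<xi> / R) * cos (x * \<xi>)) (at \<xi>)" for R \<xi>
      by (rule fejer_cos_deriv[OF x])
    show "continuous_on UNIV (\<lambda>\<xi>. (1 - \<xi> / R) * cos (x * \<xi>))" for R
      unfolding divide_inverse by (intro continuous_intros)
    show "\<bar>fejer_cos x R t\<bar> \<le> 1 / \<bar>x\<bar> + 2 / x\<^sup>2" if "1 \<le> R" "0 \<le> t" "t \<le> R" for R t
    proof -
      have "\<bar>1 - t / R\<bar> * (\<bar>sin (x * t)\<bar> / \<bar>x\<bar>) \<le> 1 * (1 / \<bar>x\<bar>)"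
        using that by (intro mult_mono divide_right_mono) (auto simp: abs_if divide_le_eq_1)
      moreover have "\<bar>1 - cos (x * t)\<bar> / (R * x\<^sup>2) \<le> 2 / (1 * x\<^sup>2)"
      proof (intro frac_le mult_right_mono)
        show "\<bar>1 - cos (x * t)\<bar> \<le> 2"
          using cos_ge_minus_one[of "x * t"] cos_le_one[of "x * t"] by linarith
      qed (use that x in auto)
      ultimately show ?thesis
        unfolding fejer_cos_def using that
        by (intro order.trans[OF abs_triangle_ineq add_mono]) (auto simp: abs_mult abs_divide)
    qed
    show "((\<lambda>R. fejer_cos x R t) \<longlongrightarrow> sin (x * t) / x) at_top" for t
    proof -
      have "((\<lambda>R. (1 - t / R) * (sin (x * t) / x) + (1 - cos (x * t)) / x\<^sup>2 / R) \<longlongrightarrow> (1 - 0) * (sin (x * t) / x) + 0) at_top"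
        by (intro tendsto_intros tendsto_divide_0[OF tendsto_const] filterlim_at_top_imp_at_infinity filterlim_ident)
      then show ?thesis by (simp add: fejer_cos_def mult.commute)
    qed
  qed measurable
  then have "0 \<le> (LBINT t. slope t * (sin (x * t) / x))"
  proof (rule tendsto_lowerbound)
    show "\<forall>\<^sub>F R in at_top. 0 \<le> (LBINT \<xi>:{0..R}. m \<xi> * ((1 - \<xi> / R) * cos (x * \<xi>)))"
      using eventually_gt_at_top[of 0]
    proof eventually_elim
      case (elim R)
      have "0 \<le> (LBINT \<xi>. fejer R \<xi> * (m \<xi> * cos (x * \<xi>)))"
        using fejer_positive_symbol[OF elim] by (simp add: fejer_positive_def)
      then show ?case
        using fejer_integral_even[OF continuous_on_symbol symbol_minus elim] by simp
    qed
  qed simp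
  then show ?thesis unfolding kernel_eq[OF x] by (rule mult_nonneg_nonneg[rotated]) simp
qed

section \<open>Total mass of the kernel\<close>

text \<open>
  Fubini applied to the sine transform of \<open>slope\<close>: the inner integral of \<open>sin (x * t) / x\<close> over \<open>[a, b]\<close>
  is a difference of sine integrals.
\<close>
lemma integral_kernel_interval:
  assumes "0 < a" "a \<le> b"
  shows "has_bochner_integral lborel (\<lambda>x. indicator {a..b} x * whitham_kernel x) (1 / pi * (LBINT t. slope t * (Si (b * t) - Si (a * t))))"
proof -
  let ?f = "\<lambda>x t. indicator {a..b} x / x * sin (x * t) * slope t"
  have "integrable lborel (\<lambda>x. indicator {a..b} x / a)"
    using \<open>a \<le> b\<close> by (intro integrable_divide integrable_real_indicator) (auto simp: less_top[symmetric])
  then have "integrable (lborel \<Otimes>\<^sub>M lborel) (\<lambda>(x, t). indicator {a..b} x / a * slope t)"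
    by (intro lborel_integrable_product) auto
  then have int: "integrable (lborel \<Otimes>\<^sub>M lborel) (case_prod ?f)"
  proof (rule Bochner_Integration.integrable_bound)
    show "AE z in lborel \<Otimes>\<^sub>M lborel. norm (case_prod ?f z) \<le> norm (case z of (x, t) \<Rightarrow> indicator {a..b} x / a * slope t)"
    proof (intro AE_I2, clarify)
      fix x t :: real
      show "norm (?f x t) \<le> norm (indicator {a..b} x / a * slope t)"
      proof (cases "x \<in> {a..b}")
        case True
        then have "\<bar>sin (x * t)\<bar> / x \<le> 1 / a" using assms by (intro frac_le) auto
        from mult_right_mono[OF this slope_nonneg[of t]] show ?thesis
          using True assms slope_nonneg[of t] by (simp add: abs_mult)
      qed simp
    qed
  qed measurable
  have inner1: "(LBINT t. ?f x t) = pi * (indicator {a..b} x * whitham_kernel x)" for x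
  proof (cases "x \<in> {a..b}")
    case True
    then have "(LBINT t. ?f x t) = (LBINT t. slope t * (sin (x * t) / x))"
      by (intro Bochner_Integration.integral_cong) auto
    then show ?thesis using True assms by (simp add: kernel_eq)
  qed simp
  have inner2: "(LBINT x. ?f x t) = slope t * (Si (b * t) - Si (a * t))" for t
  proof (cases "t \<le> 0")
    case False
    have "(\<integral>x. (sinc (x * t) * t) * indicator {a..b} x \<partial>lborel) = Si (b * t) - Si (a * t)"
    proof (rule integral_FTC_Icc_real[OF \<open>a \<le> b\<close>])
      fix x
      show "((\<lambda>x. Si (x * t)) has_real_derivative sinc (x * t) * t) (at x)"
        by (rule DERIV_chain2[OF DERIV_Si DERIV_cmult_right[OF DERIV_ident, simplified]])
      show "isCont (\<lambda>x. sinc (x * t) * t) x"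
        by (intro continuous_mult isCont_o2[OF _ isCont_sinc]) auto
    qed
    moreover have "?f x t = slope t * ((sinc (x * t) * t) * indicator {a..b} x)" for x
      using False assms by (auto simp: indicator_def)
    ultimately show ?thesis by simp
  qed (simp add: slope_def)
  have "integrable lborel (\<lambda>x. LBINT t. ?f x t)"
    using lborel_pair.integrable_fst'[OF int] by simp
  then have "integrable lborel (\<lambda>x. indicator {a..b} x * whitham_kernel x)"
    unfolding inner1 by simp
  moreover have "(LBINT x. LBINT t. ?f x t) = (LBINT t. LBINT x. ?f x t)"
    by (rule lborel_pair.Fubini_integral[OF int, symmetric])
  ultimately show ?thesis unfolding inner1 inner2
    by (simp add: has_bochner_integral_iff field_simps)
qed

text \<open>
  On the intervals \<open>[1 / n, n]\<close> the integrals are \<open>1 / pi\<close> times the mean of \<open>Si (n * t) - Si (t / n)\<close>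
  under the probability density \<open>slope\<close>, and the sine integral is bounded, so they tend to
  \<open>1 / pi * (pi / 2)\<close>. Positivity of the kernel turns this improper integral into a Lebesgue
  integral by monotone convergence, and evenness doubles it.
\<close>
lemma has_bochner_integral_kernel:
  "has_bochner_integral lborel whitham_kernel 1"
proof -
  define a where "a n = inverse (real (Suc n))" for n
  define b where "b n = real (Suc n)" for n
  have ab: "0 < a n" "a n \<le> b n" for n
    by (auto simp: a_def b_def inverse_le_1_iff order.trans[of _ 1])
  have a0: "a \<longlonglongrightarrow> 0" unfolding a_def by (rule LIMSEQ_inverse_real_of_nat)
  have b_inf: "filterlim b at_top sequentially" unfolding b_def by real_asymp
  let ?f = "\<lambda>n x. indicator {a n..b n} x * whitham_kernel x"
  obtain B where B: "\<And>T. \<bar>Si T\<bar> \<le> B" using bounded_Si by blast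
  have "(\<lambda>n. LBINT t. slope t * (Si (b n * t) - Si (a n * t))) \<longlonglongrightarrow> (LBINT t. slope t * (pi / 2))"
  proof (rule integral_dominated_convergence)
    show "integrable lborel (\<lambda>t. slope t * (2 * B))" by simp
    show "AE t in lborel. norm (slope t * (Si (b n * t) - Si (a n * t))) \<le> slope t * (2 * B)" for n
    proof (intro AE_I2)
      fix t
      have "\<bar>Si (b n * t) - Si (a n * t)\<bar> \<le> 2 * B"
        using B[of "b n * t"] B[of "a n * t"] by linarith
      then show "norm (slope t * (Si (b n * t) - Si (a n * t))) \<le> slope t * (2 * B)"
        using slope_nonneg[of t] by (simp add: abs_mult mult_left_mono)
    qed
    show "AE t in lborel. (\<lambda>n. slope t * (Si (b n * t) - Si (a n * t))) \<longlonglongrightarrow> slope t * (pi / 2)"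
    proof (intro AE_I2)
      fix t
      show "(\<lambda>n. slope t * (Si (b n * t) - Si (a n * t))) \<longlonglongrightarrow> slope t * (pi / 2)"
      proof (cases "t \<le> 0")
        case False
        then have "filterlim (\<lambda>n. b n * t) at_top sequentially"
          using filterlim_tendsto_pos_mult_at_top[OF tendsto_const[of t] _ b_inf] by (simp add: mult.commute)
        then have 1: "(\<lambda>n. Si (b n * t)) \<longlonglongrightarrow> pi / 2" by (rule filterlim_compose[OF Si_at_top])
        have "(\<lambda>n. Si (a n * t)) \<longlonglongrightarrow> Si (0 * t)"
          by (intro isCont_tendsto_compose[OF isCont_Si] tendsto_intros a0)
        moreover have "Si 0 = 0" using Si_neg[of 0] by simp
        ultimately have 2: "(\<lambda>n. Si (a n * t)) \<longlonglongrightarrow> 0" by simp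
        show ?thesis using tendsto_mult[OF tendsto_const[of "slope t"] tendsto_diff[OF 1 2]] by simp
      qed (simp add: slope_def)
    qed
  qed auto
  then have lim: "(\<lambda>n. 1 / pi * (LBINT t. slope t * (Si (b n * t) - Si (a n * t)))) \<longlonglongrightarrow> 1 / pi * (LBINT t. slope t * (pi / 2))"
    by (intro tendsto_mult tendsto_const)
  note fn = integral_kernel_interval[OF ab]
  have pos: "0 \<le> ?f n x" for n x
    using ab(1)[of n] kernel_nonneg[of x] by (auto simp: indicator_def)
  have mono: "mono (\<lambda>n. ?f n x)" for x
  proof (rule monoI)
    fix i j :: nat assume "i \<le> j"
    then have "a j \<le> a i" "b i \<le> b j" by (auto simp: a_def b_def le_imp_inverse_le)
    then show "?f i x \<le> ?f j x"
      using pos[of j x] by (auto simp: indicator_def)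
  qed
  have lim_pt: "(\<lambda>n. ?f n x) \<longlonglongrightarrow> indicator {0<..} x * whitham_kernel x" for x
  proof (cases "0 < x")
    case True
    have "\<forall>\<^sub>F n in sequentially. x = x \<and> a n < x" using order_tendstoD(2)[OF a0 True] by simp
    moreover have "\<forall>\<^sub>F n in sequentially. x \<le> b n" using b_inf by (simp add: filterlim_at_top)
    ultimately have "\<forall>\<^sub>F n in sequentially. ?f n x = indicator {0<..} x * whitham_kernel x"
      by eventually_elim (use True in auto)
    then show ?thesis by (rule tendsto_eventually)
  next
    case False
    then have zero: "?f n x = 0" for n using ab(1)[of n] by auto
    show ?thesis unfolding zero using False by simp
  qed
  have int: "integrable lborel (?f n)" and val: "integral\<^sup>L lborel (?f n) = 1 / pi * (LBINT t. slope t * (Si (b n * t) - Si (a n * t)))" for n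
    using fn[of n] by (auto simp: has_bochner_integral_iff)
  have ilim: "(\<lambda>n. integral\<^sup>L lborel (?f n)) \<longlonglongrightarrow> 1 / 2"
    using lim unfolding val by (simp add: integral_slope)
  have "has_bochner_integral lborel (\<lambda>x. indicator {0<..} x * whitham_kernel x) (1 / 2)"
    unfolding has_bochner_integral_iff
    using integral_monotone_convergence_nonneg[OF int AE_I2[OF mono] AE_I2[OF pos] AE_I2[OF lim_pt] ilim] by simp
  then have "has_bochner_integral lborel whitham_kernel (2 * (1 / 2))"
    by (intro has_bochner_integral_even kernel_even) auto
  then show ?thesis by simp
qed

lemma integrable_kernel: "integrable lborel whitham_kernel"
  and integral_kernel: "(LBINT x. whitham_kernel x) = 1"
  using has_bochner_integral_kernel by (auto simp: has_bochner_integral_iff)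

section \<open>Lower bound for the wave speed\<close>

lemma holder_continuous:
  assumes f: "f \<in> holder_space a" and a: "0 < a"
  shows "continuous_on UNIV f"
proof (rule continuous_at_imp_continuous_on, clarify)
  fix x :: real
  obtain C where C: "\<And>x y. \<bar>f x - f y\<bar> \<le> C * \<bar>x - y\<bar> powr a"
    using f by (auto simp: holder_space_def)
  have "((\<lambda>y. \<bar>y - x\<bar>) \<longlongrightarrow> 0) (at x)"
    using tendsto_rabs[OF LIM_zero[OF tendsto_ident_at[of x UNIV]]] by simp
  then have "((\<lambda>y. \<bar>y - x\<bar> powr a) \<longlongrightarrow> 0) (at x)"
    using a by (intro tendsto_zero_powrI[OF _ tendsto_const]) auto
  then have "((\<lambda>y. C * \<bar>y - x\<bar> powr a) \<longlongrightarrow> 0) (at x)"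
    by (rule tendsto_mult_right_zero)
  then have "((\<lambda>y. f y - f x) \<longlongrightarrow> 0) (at x)"
  proof (rule Lim_null_comparison[rotated])
    show "\<forall>\<^sub>F y in at x. norm (f y - f x) \<le> C * \<bar>y - x\<bar> powr a"
      using C by (intro always_eventually allI) simp
  qed
  then show "isCont f x" unfolding isCont_def by (rule LIM_zero_cancel)
qed

text \<open>
  A lower bound for \<open>\<mu> / 2 - \<phi>\<close> away from the other crests. The regularity estimate covers only
  \<open>\<bar>y\<bar> \<le> \<delta>\<close>; beyond that the value at \<open>\<delta>\<close> persists, because the wave keeps decreasing up to half a
  period.
\<close>
definition deficit :: "real \<Rightarrow> real \<Rightarrow> real" where
  "deficit \<delta> y = \<delta> * min \<bar>y\<bar> \<delta> powr (1/2)"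

lemma admissible_deficit:
  assumes reg: "regularity_estimate \<delta>" and adm: "admissible_pair P lam \<phi> \<mu>" and P: "1 \<le> P"
    and y: "\<bar>y\<bar> < P / 2"
  shows "deficit \<delta> y \<le> \<mu> / 2 - \<phi> y"
proof -
  have R: "\<delta> * \<bar>x\<bar> powr (1/2) \<le> \<mu> / 2 - \<phi> x" if "\<bar>x\<bar> \<le> \<delta>" for x
  proof -
    have "0 < lam" "lam \<le> 1" using adm by (auto simp: admissible_pair_def)
    then show ?thesis using reg adm P that unfolding regularity_estimate_def by blast
  qed
  have \<delta>: "0 < \<delta>" using reg by (simp add: regularity_estimate_def)
  show ?thesis
  proof (cases "\<bar>y\<bar> \<le> \<delta>")
    case True
    then show ?thesis using R[of y] by (simp add: deficit_def)
  next
    case False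
    have even: "\<phi> (- x) = \<phi> x" for x using adm by (simp add: admissible_pair_def)
    have "strict_mono_on {- P / 2<..<0} \<phi>" using adm by (simp add: admissible_pair_def)
    then have "\<phi> (- \<bar>y\<bar>) < \<phi> (- \<delta>)"
      using False \<delta> y by (auto simp: strict_mono_on_def)
    then have "\<phi> y < \<phi> \<delta>" by (cases "0 \<le> y") (auto simp: even)
    then show ?thesis using R[of \<delta>] False \<delta> by (simp add: deficit_def)
  qed
qed

definition kernel_deficit :: "real \<Rightarrow> real \<Rightarrow> real" where
  "kernel_deficit \<delta> r = (LBINT y. whitham_kernel y * (indicator {-r<..<r} y * deficit \<delta> y))"

lemma kernel_nonneg_AE: "AE y in lborel. 0 \<le> whitham_kernel y"
  using AE_lborel_singleton[of 0] by eventually_elim (rule kernel_nonneg)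

lemma integrable_kernel_mult:
  assumes [measurable]: "f \<in> borel_measurable borel" and "\<And>y. \<bar>f y\<bar> \<le> B"
  shows "integrable lborel (\<lambda>y. whitham_kernel y * f y)"
proof (rule Bochner_Integration.integrable_bound)
  show "integrable lborel (\<lambda>y. whitham_kernel y * B)" using integrable_kernel by simp
  show "AE y in lborel. norm (whitham_kernel y * f y) \<le> norm (whitham_kernel y * B)"
    using assms(2) by (intro AE_I2) (simp add: abs_mult mult_left_mono order.trans[OF _ abs_ge_self])
qed measurable

lemma deficit_bounds: "0 < \<delta> \<Longrightarrow> 0 \<le> deficit \<delta> y" "0 < \<delta> \<Longrightarrow> deficit \<delta> y \<le> \<delta> * \<delta> powr (1/2)"
  by (auto simp: deficit_def intro!: mult_left_mono powr_mono2)

lemma deficit_measurable [measurable]: "deficit \<delta> \<in> borel_measurable borel"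
  unfolding deficit_def by measurable

text \<open>
  At the crest the equation reads \<open>L \<phi> 0 = \<phi> 0 * (\<mu> - \<phi> 0)\<close>, which is nonnegative because
  \<open>\<phi> 0 \<le> \<mu> / 2\<close>. A wave of very small speed would lie below zero by at least about the deficit near
  the crest and could not rise much above zero elsewhere, so its average \<open>L \<phi> 0\<close> would be negative.
\<close>
lemma admissible_speed_ge:
  assumes reg: "regularity_estimate \<delta>" and adm: "admissible_pair P lam \<phi> \<mu>" and P: "1 \<le> P"
    and r: "r \<le> P / 2"
  shows "2 * kernel_deficit \<delta> r \<le> \<mu>"
proof -
  have lam: "0 < lam" "lam \<le> 1" and \<mu>: "0 < \<mu>" "\<mu> \<le> 1" and \<phi>0: "\<phi> 0 = lam * \<mu> / 2"
    and le: "\<phi> x \<le> \<phi> 0" and sol: "solution_pair \<phi> \<mu>" and hol: "\<phi> \<in> holder_space (1/2)" for x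
    using adm by (auto simp: admissible_pair_def)
  have \<delta>: "0 < \<delta>" using reg by (simp add: regularity_estimate_def)
  have [measurable]: "\<phi> \<in> borel_measurable borel"
    using holder_continuous[OF hol] by (intro borel_measurable_continuous_onI) auto
  obtain B where B: "\<And>y. \<bar>\<phi> y\<bar> \<le> B"
    using hol by (auto simp: holder_space_def bounded_iff)
  let ?w = "\<lambda>y. indicator {-r<..<r} y * deficit \<delta> y"
  have w: "\<bar>?w y\<bar> \<le> \<delta> * \<delta> powr (1/2)" for y
    using deficit_bounds[OF \<delta>, of y] by (auto simp: indicator_def)
  have lam\<mu>: "lam * \<mu> \<le> \<mu>" using lam \<mu> by simp
  have le\<mu>: "\<phi> y \<le> \<mu> / 2 - ?w y" for y
  proof (cases "y \<in> {-r<..<r}")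
    case True
    then have "\<bar>y\<bar> < P / 2" using r by auto
    then show ?thesis using admissible_deficit[OF reg adm P, of y] True by simp
  next
    case False
    then show ?thesis using le[of y] \<phi>0 lam\<mu> by simp
  qed
  have iw: "integrable lborel (\<lambda>y. whitham_kernel y * ?w y)"
    by (rule integrable_kernel_mult[OF _ w]) measurable
  have "0 \<le> \<phi> 0 * (\<mu> - \<phi> 0)"
    using lam \<mu> lam\<mu> unfolding \<phi>0 by (intro mult_nonneg_nonneg) auto
  also have "\<phi> 0 * (\<mu> - \<phi> 0) = whitham_op \<phi> 0"
    using sol[unfolded solution_pair_def, rule_format, of 0] by (simp add: algebra_simps power2_eq_square)
  also have "\<dots> = (LBINT y. whitham_kernel y * \<phi> y)"
    by (simp add: whitham_op_def kernel_even)
  also have "\<dots> \<le> (LBINT y. whitham_kernel y * (\<mu> / 2) - whitham_kernel y * ?w y)"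
  proof (rule integral_mono_AE)
    show "integrable lborel (\<lambda>y. whitham_kernel y * \<phi> y)"
      by (rule integrable_kernel_mult[OF _ B]) measurable
    show "integrable lborel (\<lambda>y. whitham_kernel y * (\<mu> / 2) - whitham_kernel y * ?w y)"
      using iw integrable_kernel by (intro Bochner_Integration.integrable_diff) auto
    show "AE y in lborel. whitham_kernel y * \<phi> y \<le> whitham_kernel y * (\<mu> / 2) - whitham_kernel y * ?w y"
      using kernel_nonneg_AE
    proof eventually_elim
      case (elim y)
      then show ?case using mult_left_mono[OF le\<mu>[of y] elim] by (simp add: right_diff_distrib)
    qed
  qed
  also have "\<dots> = \<mu> / 2 - kernel_deficit \<delta> r"
    using iw integrable_kernel by (simp add: kernel_deficit_def integral_kernel)
  finally show ?thesis by simp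
qed

text \<open>
  If the integral of \<open>K * deficit \<delta>\<close> over the line vanished, then so would \<open>K\<close> almost everywhere,
  contrary to its mass 1. By dominated convergence a bounded interval already captures a positive
  part of that integral.
\<close>
lemma kernel_deficit_pos:
  assumes \<delta>: "0 < \<delta>"
  obtains r where "0 < kernel_deficit \<delta> r"
proof -
  let ?w = "\<lambda>n y. indicator {- real n<..<real n} y * deficit \<delta> y"
  let ?C = "\<delta> * \<delta> powr (1/2)"
  have lim: "(\<lambda>n. kernel_deficit \<delta> (real n)) \<longlonglongrightarrow> (LBINT y. whitham_kernel y * deficit \<delta> y)"
    unfolding kernel_deficit_def
  proof (rule integral_dominated_convergence)
    show "integrable lborel (\<lambda>y. whitham_kernel y * ?C)" using integrable_kernel by simp
    show "AE y in lborel. norm (whitham_kernel y * ?w n y) \<le> whitham_kernel y * ?C" for n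
      using kernel_nonneg_AE
    proof eventually_elim
      case (elim y)
      have "\<bar>?w n y\<bar> \<le> ?C" using deficit_bounds[OF \<delta>, of y] by (auto simp: indicator_def)
      then show ?case using elim by (simp add: abs_mult mult_left_mono)
    qed
    show "AE y in lborel. (\<lambda>n. whitham_kernel y * ?w n y) \<longlonglongrightarrow> whitham_kernel y * deficit \<delta> y"
    proof (intro AE_I2 tendsto_mult tendsto_const)
      fix y :: real
      have "\<forall>\<^sub>F n in sequentially. \<bar>y\<bar> < real n"
        using filterlim_real_sequentially by (simp add: filterlim_at_top_dense)
      then have "\<forall>\<^sub>F n in sequentially. ?w n y = deficit \<delta> y"
      proof eventually_elim
        case (elim n)
        then have "y \<in> {- real n<..<real n}" by (auto simp: abs_less_iff)
        then show ?case by simp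
      qed
      then show "(\<lambda>n. ?w n y) \<longlonglongrightarrow> deficit \<delta> y" by (rule tendsto_eventually)
    qed
  qed measurable
  have nonneg: "AE y in lborel. 0 \<le> whitham_kernel y * deficit \<delta> y"
    using kernel_nonneg_AE by eventually_elim (simp add: deficit_bounds[OF \<delta>])
  have int: "integrable lborel (\<lambda>y. whitham_kernel y * deficit \<delta> y)"
    using deficit_bounds[OF \<delta>] by (intro integrable_kernel_mult[where B = ?C]) auto
  have "(LBINT y. whitham_kernel y * deficit \<delta> y) \<noteq> 0"
  proof
    assume "(LBINT y. whitham_kernel y * deficit \<delta> y) = 0"
    then have "AE y in lborel. whitham_kernel y * deficit \<delta> y = 0"
      using integral_nonneg_eq_0_iff_AE[OF int nonneg] by simp
    then have "AE y in lborel. whitham_kernel y = 0"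
      using AE_lborel_singleton[of 0] by eventually_elim (use \<delta> in \<open>auto simp: deficit_def min_def split: if_splits\<close>)
    then have "(LBINT y. whitham_kernel y) = 0" by (rule integral_eq_zero_AE)
    then show False by (simp add: integral_kernel)
  qed
  then have "0 < (LBINT y. whitham_kernel y * deficit \<delta> y)"
    using integral_nonneg_AE[OF nonneg] by simp
  then have "\<forall>\<^sub>F n in sequentially. 0 < kernel_deficit \<delta> (real n)"
    by (rule order_tendstoD(1)[OF lim])
  then have "\<exists>n. 0 < kernel_deficit \<delta> (real n)"
    by (intro eventually_happens') auto
  then show thesis using that by blast
qed

lemma limiting_speed_ge:
  assumes reg: "regularity_estimate \<delta>" and lim: "limiting_pair lam \<phi> \<nu>"
  shows "2 * kernel_deficit \<delta> r \<le> \<nu>" and "\<phi> 0 = lam * \<nu> / 2"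
proof -
  obtain P \<phi>s \<mu>s where adm: "\<And>n. admissible_pair (P n) lam (\<phi>s n) (\<mu>s n)"
    and P: "filterlim P at_top sequentially"
    and unif: "\<And>C. compact C \<Longrightarrow> uniform_limit C \<phi>s \<phi> sequentially" and \<mu>s: "\<mu>s \<longlonglongrightarrow> \<nu>"
    using lim unfolding limiting_pair_def by blast
  have "\<forall>\<^sub>F n in sequentially. max 1 (2 * r) \<le> P n"
    using P unfolding filterlim_at_top by blast
  then have "\<forall>\<^sub>F n in sequentially. 2 * kernel_deficit \<delta> r \<le> \<mu>s n"
    by eventually_elim (rule admissible_speed_ge[OF reg adm], auto)
  then show "2 * kernel_deficit \<delta> r \<le> \<nu>"
    by (intro tendsto_lowerbound[OF \<mu>s]) auto
  have "(\<lambda>n. \<phi>s n 0) \<longlonglongrightarrow> \<phi> 0"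
    using tendsto_uniform_limitI[OF unif[of "{0}"]] by simp
  moreover have "\<phi>s n 0 = lam * \<mu>s n / 2" for n
    using adm[of n] by (simp add: admissible_pair_def)
  ultimately have "(\<lambda>n. lam * \<mu>s n / 2) \<longlonglongrightarrow> \<phi> 0" by simp
  moreover have "(\<lambda>n. lam * \<mu>s n / 2) \<longlonglongrightarrow> lam * \<nu> / 2"
    by (intro tendsto_intros \<mu>s) simp
  ultimately show "\<phi> 0 = lam * \<nu> / 2" by (rule LIMSEQ_unique)
qed

theorem proposition4p8:
  fixes \<delta> :: real
  assumes "regularity_estimate \<delta>"
  shows
    "(\<forall>lam\<in>{0<..1}. \<forall>\<phi> \<nu>. limiting_pair lam \<phi> \<nu> \<longrightarrow>
        solitary_speed \<nu> <
          2 / (2 - relative_height (solitary_wave \<phi> \<nu>) (solitary_speed \<nu>))) \<and>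
     (\<exists>\<alpha>\<^sub>0\<in>{0<..<1}. \<exists>\<epsilon>>0.
        \<forall>lam\<in>{0<..1}. \<forall>\<phi> \<nu>. limiting_pair lam \<phi> \<nu> \<longrightarrow>
          relative_height (solitary_wave \<phi> \<nu>) (solitary_speed \<nu>) \<ge> \<alpha>\<^sub>0 \<longrightarrow>
          solitary_speed \<nu> \<le> 2 - \<epsilon>)"
proof -
  have "0 < \<delta>" using assms by (simp add: regularity_estimate_def)
  then obtain r where r: "0 < kernel_deficit \<delta> r" by (rule kernel_deficit_pos)
  define \<epsilon> where "\<epsilon> = 2 * kernel_deficit \<delta> r"
  have \<epsilon>: "0 < \<epsilon>" using r by (simp add: \<epsilon>_def)
  have \<nu>: "\<epsilon> \<le> \<nu>" if "limiting_pair lam \<phi> \<nu>" for lam \<phi> \<nu>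
    unfolding \<epsilon>_def by (rule limiting_speed_ge(1)[OF assms that])
  have "solitary_speed \<nu> < 2 / (2 - relative_height (solitary_wave \<phi> \<nu>) (solitary_speed \<nu>))"
    if lam: "lam \<in> {0<..1}" and lim: "limiting_pair lam \<phi> \<nu>" for lam \<phi> \<nu>
  proof -
    have \<nu>01: "0 < \<nu>" "\<nu> \<le> 1" using \<nu>[OF lim] \<epsilon> lim by (auto simp: limiting_pair_def)
    have "lam * \<nu> \<le> 1" using lam \<nu>01 by (auto intro: mult_le_one)
    moreover have "0 < lam * \<nu>" using lam \<nu>01 by simp
    moreover have "2 - relative_height (solitary_wave \<phi> \<nu>) (solitary_speed \<nu>) = (2 - lam * \<nu>) / (2 - \<nu>)"
      using \<nu>01 limiting_speed_ge(2)[OF assms lim]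
      by (simp add: relative_height_def solitary_wave_def solitary_speed_def field_simps)
    ultimately show ?thesis using \<nu>01 mult_strict_left_mono[of "2 - lam * \<nu>" 2 "2 - \<nu>"]
      by (simp add: solitary_speed_def less_divide_eq)
  qed
  moreover have "solitary_speed \<nu> \<le> 2 - \<epsilon>" if "limiting_pair lam \<phi> \<nu>" for lam \<phi> \<nu>
    using \<nu>[OF that] by (simp add: solitary_speed_def)
  ultimately show ?thesis using \<epsilon>
    by (intro conjI ballI allI impI bexI[of _ "1/2"] exI[of _ \<epsilon>]) auto
qed

end
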